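(* Assume $\operatorname{tr}B\ge0$ and let $0<s<1$ and $1\le p<\infty$. Then for every $f\in\mathscr S$ and every $t,\tau>0$, $$\|P_tf-P_\tau f\|_{L^p}\le\frac{2|t-\tau|^s}{\Gamma(1+s)}\ \sup_{\sigma>0}\|(-\mathscr A)^sP_\sigma f\|_{L^p}.$$
   Context: Let $N\ge 2$. Let $Q,B$ be real constant $N\times N$ matrices with $Q=Q^\star\ge 0$, $\mathscr A u=\operatorname{tr}(Q\nabla^2u)+\langle BX,\nabla u\rangle$, and assume $K(t)=\frac1t\int_0^t e^{rB}Qe^{rB^\star}\,dr$ is positive definite for every $t>0$. Let $m_t(X,Y)^2=\langle K(t)^{-1}(Y-e^{tB}X),\,Y-e^{tB}X\rangle$, $p(X,Y,t)=(4\pi)^{-N/2}(\det(tK(t)))^{-1/2}\exp(-m_t(X,Y)^2/(4t))$, $P_tf(X)=\int p(X,Y,t)f(Y)\,dY$. $\mathscr S$ is the Schwartz class. For $0<s<1$ and $f\in\mathscr S$, $(-\mathscr A)^sf(X)=-\frac{s}{\Gamma(1-s)}\int_0^\infty t^{-1-s}[P_tf(X)-f(X)]\,dt$. *)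

theory Defs
  imports "HOL-Analysis.Analysis"
begin

fun mpow :: "real^'n^'n \<Rightarrow> nat \<Rightarrow> real^'n^'n" where
  "mpow A 0 = mat 1"
| "mpow A (Suc k) = A ** mpow A k"

definition mexp :: "real^'n^'n \<Rightarrow> real^'n^'n" where
  "mexp A = (\<Sum>k. (1 / fact k) *\<^sub>R mpow A k)"

definition Kmat :: "real^'n^'n \<Rightarrow> real^'n^'n \<Rightarrow> real \<Rightarrow> real^'n^'n" where
  "Kmat Q B t = (1 / t) *\<^sub>R
     integral {0..t} (\<lambda>r. mexp (r *\<^sub>R B) ** Q ** transpose (mexp (r *\<^sub>R B)))"

definition pos_def_mat :: "real^'n^'n \<Rightarrow> bool" where
  "pos_def_mat M \<longleftrightarrow> (\<forall>x. x \<noteq> 0 \<longrightarrow> 0 < x \<bullet> (M *v x))"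

definition msq :: "real^'n^'n \<Rightarrow> real^'n^'n \<Rightarrow> real \<Rightarrow> real^'n \<Rightarrow> real^'n \<Rightarrow> real" where
  "msq Q B t X Y =
     (matrix_inv (Kmat Q B t) *v (Y - mexp (t *\<^sub>R B) *v X)) \<bullet> (Y - mexp (t *\<^sub>R B) *v X)"

definition pker :: "real^'n^'n \<Rightarrow> real^'n^'n \<Rightarrow> real^'n \<Rightarrow> real^'n \<Rightarrow> real \<Rightarrow> real" where
  "pker Q B X Y t =
     (4 * pi) powr (- real CARD('n) / 2) * (det (t *\<^sub>R Kmat Q B t)) powr (-1/2)
     * exp (- msq Q B t X Y / (4 * t))"

definition Psemi :: "real^'n^'n \<Rightarrow> real^'n^'n \<Rightarrow> real \<Rightarrow> (real^'n \<Rightarrow> real) \<Rightarrow> real^'n \<Rightarrow> real" where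
  "Psemi Q B t f X = (\<integral>Y. pker Q B X Y t * f Y \<partial>lborel)"

definition frac_pow :: "real^'n^'n \<Rightarrow> real^'n^'n \<Rightarrow> real \<Rightarrow> (real^'n \<Rightarrow> real) \<Rightarrow> real^'n \<Rightarrow> real" where
  "frac_pow Q B s f X =
     - (s / Gamma (1 - s)) *
       (\<integral>t. indicator {0<..} t * (t powr (-1 - s) * (Psemi Q B t f X - f X)) \<partial>lborel)"

fun pderivs :: "'n list \<Rightarrow> (real^'n \<Rightarrow> real) \<Rightarrow> real^'n \<Rightarrow> real" where
  "pderivs [] g = g"
| "pderivs (i # is) g = (\<lambda>x. frechet_derivative (pderivs is g) (at x) (axis i 1))"

definition schwartz :: "(real^'n \<Rightarrow> real) \<Rightarrow> bool" where
  "schwartz f \<longleftrightarrow>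
     (\<forall>is x. pderivs is f differentiable (at x)) \<and>
     (\<forall>is (k::nat). \<exists>C. \<forall>x. (1 + norm x) ^ k * \<bar>pderivs is f x\<bar> \<le> C)"

definition Lp_norm :: "real \<Rightarrow> (real^'n \<Rightarrow> real) \<Rightarrow> ennreal" where
  "Lp_norm p g =
     (let I = (\<integral>\<^sup>+ x. ennreal (\<bar>g x\<bar> powr p) \<partial>lborel)
      in if I = \<infinity> then \<infinity> else ennreal ((enn2real I) powr (1 / p)))"

end

theory Submission
  imports Defs "HOL-Probability.Probability" "HOL-Real_Asymp.Real_Asymp"
begin

text \<open>Fix \<open>X\<close> and put \<open>u(r) = P_r f(X)\<close>. By the semigroup law, \<open>(-A)^s P_r f(X)\<close> is the Marchaud
  fractional derivative of the scalar function \<open>u\<close> at \<open>r\<close>, and for bounded Lipschitz \<open>u\<close> this is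
  inverted by
  \<open>u(t) - u(\<tau>) = 1/\<Gamma>(s) \<integral> k(r) (-A)^s P_r f(X) dr\<close> with
  \<open>k(r) = (r - t)_+^(s-1) - (r - \<tau>)_+^(s-1)\<close>, whose \<open>L^1\<close> norm is \<open>2 |t - \<tau>|^s / s\<close>.
  Minkowski's inequality (here Jensen and Tonelli) gives the estimate.
  The Lipschitz bound for \<open>u\<close> follows from \<open>|P_h f - f| \<le> L h\<close> for small \<open>h\<close>, which for Schwartz
  functions is a second-order Taylor expansion under the Gaussian law of covariance
  \<open>2 \<integral>_0^h e^(rB) Q e^(rB)^T dr = O(h)\<close>.\<close>

section \<open>The matrix exponential\<close>

text \<open>The bounds on P_r f(X) carry no decay as r grows, and a single kernel (r - a)_+^(s-1) is
  not integrable at infinity, so inversion at one base point is out of reach for such functions. The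
  difference of the kernels of two base points decays like r^(s-2) and is integrable; this is why
  increments in time are represented. For C^1 functions that vanish far to the right, inversion at
  one base point is integration by parts followed by Fubini, where the inner integral Beta(s, 1 - s)
  = Gamma(s) Gamma(1 - s) does not depend on its end point. Lipschitz functions are reached by
  dominated convergence, so a Lipschitz bound in time is all that the semigroup has to supply. The
  factor 2 / Gamma(1 + s) is 2 / s, from the mass of the kernel difference, divided by Gamma(s). To
  the left of the smaller time the function u is frozen: the Marchaud derivative looks only forward,
  so nothing changes where the kernel lives.\<close>

lemma bounded_bilinear_matrix_matrix_mult:
  "bounded_bilinear ((**) :: real^'n^'m \<Rightarrow> real^'k^'n \<Rightarrow> real^'k^'m)"
  unfolding bilinear_conv_bounded_bilinear[symmetric] bilinear_def
  by (auto intro!: linearI simp: vec_eq_iff matrix_matrix_mult_def sum.distrib sum_distrib_left algebra_simps)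

lemma bounded_bilinear_matrix_vector_mult:
  "bounded_bilinear ((*v) :: real^'n^'m \<Rightarrow> real^'n \<Rightarrow> real^'m)"
  unfolding bilinear_conv_bounded_bilinear[symmetric] bilinear_def
  by (auto intro!: linearI simp: vec_eq_iff matrix_vector_mult_def sum.distrib sum_distrib_left
      algebra_simps)

lemma bounded_linear_transpose: "bounded_linear (transpose :: real^'n^'m \<Rightarrow> real^'m^'n)"
  unfolding linear_conv_bounded_linear[symmetric]
  by (auto intro!: linearI simp: vec_eq_iff transpose_def)

lemmas continuous_on_matrix_mult [continuous_intros] =
  bounded_bilinear.continuous_on[OF bounded_bilinear_matrix_matrix_mult]
lemmas continuous_on_matrix_vector_mult [continuous_intros] =
  bounded_bilinear.continuous_on[OF bounded_bilinear_matrix_vector_mult]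
lemmas continuous_on_transpose [continuous_intros] =
  bounded_linear.continuous_on[OF bounded_linear_transpose]

text \<open>The norm enters only through bounded bilinearity of the product, with some constant
  \<open>K\<close>; this bounds the powers by a geometric sequence in \<open>norm A * K\<close>, and
  the scalar exponential series of that number is the majorant.\<close>

lemma summable_mexp: "summable (\<lambda>k. norm ((1 / fact k) *\<^sub>R mpow (A :: real^'n^'n) k))"
proof -
  obtain K where K: "K > 0" "\<And>(X :: real^'n^'n) (Y :: real^'n^'n). norm (X ** Y) \<le> norm X * norm Y * K"
    using bounded_bilinear.pos_bounded[OF bounded_bilinear_matrix_matrix_mult] by blast
  have b: "norm (mpow A k) \<le> norm (mat 1 :: real^'n^'n) * (norm A * K) ^ k" for k
  proof (induction k)
    case (Suc k)
    have "norm (mpow A (Suc k)) \<le> (norm A * K) * norm (mpow A k)"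
      using K(2)[of A "mpow A k"] by (simp add: mult_ac)
    also have "\<dots> \<le> (norm A * K) * (norm (mat 1 :: real^'n^'n) * (norm A * K) ^ k)"
      using K(1) Suc by (intro mult_left_mono) auto
    finally show ?case by (simp add: mult_ac)
  qed simp
  have "summable (\<lambda>k. norm (mat 1 :: real^'n^'n) * ((norm A * K) ^ k /\<^sub>R fact k))"
    by (intro summable_mult summable_exp_generic)
  then show ?thesis
    by (rule summable_comparison_test'[where N = 0])
      (use b in \<open>auto simp: field_simps\<close>)
qed

lemma mexp_sums: "(\<lambda>k. (1 / fact k) *\<^sub>R mpow A k) sums mexp A"
  unfolding mexp_def by (intro summable_sums summable_norm_cancel[OF summable_mexp])

lemma mpow_scaleR: "mpow (r *\<^sub>R A) k = r ^ k *\<^sub>R mpow A k"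
  by (induction k) (simp_all add: bounded_bilinear.scaleR_left[OF bounded_bilinear_matrix_matrix_mult]
      bounded_bilinear.scaleR_right[OF bounded_bilinear_matrix_matrix_mult])

lemma mpow_commute: "mpow A k ** A = A ** mpow A k"
  by (induction k) (simp_all add: matrix_mul_assoc[symmetric])

lemma mexp_commute: "mexp (r *\<^sub>R A) ** A = A ** mexp (r *\<^sub>R A)"
proof -
  have 1: "(\<lambda>k. (1 / fact k) *\<^sub>R mpow (r *\<^sub>R A) k ** A) sums (mexp (r *\<^sub>R A) ** A)"
    by (intro bounded_linear.sums[OF bounded_bilinear.bounded_linear_left
          [OF bounded_bilinear_matrix_matrix_mult]] mexp_sums)
  have 2: "(\<lambda>k. A ** ((1 / fact k) *\<^sub>R mpow (r *\<^sub>R A) k)) sums (A ** mexp (r *\<^sub>R A))"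
    by (intro bounded_linear.sums[OF bounded_bilinear.bounded_linear_right
          [OF bounded_bilinear_matrix_matrix_mult]] mexp_sums)
  have 3: "(1 / fact k) *\<^sub>R mpow (r *\<^sub>R A) k ** A = A ** ((1 / fact k) *\<^sub>R mpow (r *\<^sub>R A) k)" for k
    by (simp add: mpow_scaleR mpow_commute
      bounded_bilinear.scaleR_left[OF bounded_bilinear_matrix_matrix_mult]
      bounded_bilinear.scaleR_right[OF bounded_bilinear_matrix_matrix_mult])
  show ?thesis
    by (rule sums_unique2[OF 1[unfolded 3] 2])
qed

text \<open>Each entry is a scalar power series in \<open>r\<close> converging everywhere, hence
  differentiable term by term; the coefficient shift \<open>diffs\<close> amounts to one extra
  factor \<open>A\<close>.\<close>

lemma mexp_has_derivative:
  "((\<lambda>r. mexp (r *\<^sub>R A)) has_vector_derivative (A ** mexp (r *\<^sub>R A))) (at r)"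
proof -
  have comp: "((\<lambda>r. mexp (r *\<^sub>R A) $ i $ j) has_real_derivative ((A ** mexp (r *\<^sub>R A)) $ i $ j)) (at r)"
    for i j
  proof -
    define c where "c k = mpow A k $ i $ j / fact k" for k
    have bl: "bounded_linear (\<lambda>M :: real^'a^'a. M $ i $ j)"
      by (rule bounded_linear_compose[OF bounded_linear_vec_nth bounded_linear_vec_nth])
    have s: "(\<lambda>k. c k * r ^ k) sums (mexp (r *\<^sub>R A) $ i $ j)" for r
      using bounded_linear.sums[OF bl mexp_sums[of "r *\<^sub>R A"]]
      by (simp add: c_def mpow_scaleR mult_ac)
    have d: "diffs c k = (A ** mpow A k) $ i $ j / fact k" for k
      by (simp add: diffs_def c_def field_simps del: of_nat_Suc)
    have "(\<lambda>k. (A ** ((1 / fact k) *\<^sub>R mpow (r *\<^sub>R A) k)) $ i $ j) sums ((A ** mexp (r *\<^sub>R A)) $ i $ j)"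
      by (intro bounded_linear.sums[OF bl] bounded_linear.sums[OF bounded_bilinear.bounded_linear_right
          [OF bounded_bilinear_matrix_matrix_mult]] mexp_sums)
    then have s2: "(\<lambda>k. diffs c k * r ^ k) sums ((A ** mexp (r *\<^sub>R A)) $ i $ j)"
      by (simp add: d mpow_scaleR mult_ac
          bounded_bilinear.scaleR_right[OF bounded_bilinear_matrix_matrix_mult])
    have "((\<lambda>x. \<Sum>n. c n * x^n) has_field_derivative (\<Sum>n. diffs c n * r^n)) (at r)"
      by (rule termdiffs_strong_converges_everywhere) (use s sums_summable in blast)
    then show ?thesis
      using s s2 by (simp add: sums_iff)
  qed
  show ?thesis
    unfolding has_vector_derivative_def
    by (subst has_derivative_componentwise_within)
      (use comp in \<open>auto simp: Basis_vec_def inner_axis has_field_derivative_def mult.commute[of _ "_ $ _ $ _"]\<close>)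
qed

lemma mexp_zero [simp]: "mexp (0 :: real^'n^'n) = mat 1"
proof -
  have "mpow (0 :: real^'n^'n) k = (if k = 0 then mat 1 else 0)" for k
    by (cases k) (simp_all add: bounded_bilinear.zero_left[OF bounded_bilinear_matrix_matrix_mult])
  then have "(\<lambda>k. (1 / fact k) *\<^sub>R mpow (0 :: real^'n^'n) k) = (\<lambda>k. if k = 0 then mat 1 else 0)"
    by auto
  with mexp_sums[of "0 :: real^'n^'n"] show ?thesis
    using sums_If_finite_set[of "{0}" "\<lambda>_. mat 1 :: real^'n^'n"] sums_unique2 by fastforce
qed

lemma mexp_continuous_on: "continuous_on S (\<lambda>r. mexp (r *\<^sub>R A))"
  using mexp_has_derivative has_vector_derivative_continuous
  by (blast intro: continuous_at_imp_continuous_on)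

text \<open>The product \<open>mexp (-r A) ** mexp ((r + t) A)\<close> has derivative zero in \<open>r\<close>.\<close>

lemma mexp_add: "mexp ((r + t) *\<^sub>R A) = mexp (r *\<^sub>R A) ** mexp (t *\<^sub>R (A :: real^'n^'n))"
proof -
  have key: "mexp ((-r) *\<^sub>R A) ** mexp ((r + t) *\<^sub>R A) = mexp (t *\<^sub>R A)" for r t
  proof -
    define h where "h r = mexp ((-r) *\<^sub>R A) ** mexp ((r + t) *\<^sub>R A)" for r
    have "(h has_derivative (\<lambda>_. 0)) (at r within UNIV)" for r
    proof -
      have 1: "((\<lambda>r. mexp ((-r) *\<^sub>R A)) has_vector_derivative (-1) *\<^sub>R (A ** mexp ((-r) *\<^sub>R A))) (at r)"
        by (rule vector_diff_chain_at[of uminus "-1" r "\<lambda>r. mexp (r *\<^sub>R A)",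
              OF _ mexp_has_derivative, unfolded o_def])
          (auto intro!: derivative_eq_intros)
      have 2: "((\<lambda>r. mexp ((r + t) *\<^sub>R A)) has_vector_derivative 1 *\<^sub>R (A ** mexp ((r + t) *\<^sub>R A))) (at r)"
        by (rule vector_diff_chain_at[of "\<lambda>r. r + t" "1" r "\<lambda>r. mexp (r *\<^sub>R A)",
              OF _ mexp_has_derivative, unfolded o_def])
          (auto intro!: derivative_eq_intros)
      have "(h has_vector_derivative
          (mexp ((-r) *\<^sub>R A) ** (1 *\<^sub>R (A ** mexp ((r + t) *\<^sub>R A)))
           + ((-1) *\<^sub>R (A ** mexp ((-r) *\<^sub>R A))) ** mexp ((r + t) *\<^sub>R A))) (at r)"
        unfolding h_def
        by (rule bounded_bilinear.has_vector_derivative[OF bounded_bilinear_matrix_matrix_mult 1 2])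
      also have "mexp ((-r) *\<^sub>R A) ** (1 *\<^sub>R (A ** mexp ((r + t) *\<^sub>R A)))
           + ((-1) *\<^sub>R (A ** mexp ((-r) *\<^sub>R A))) ** mexp ((r + t) *\<^sub>R A) = 0"
        using mexp_commute[of "-r" A]
        by (simp add: matrix_mul_assoc bounded_bilinear.minus_left[OF bounded_bilinear_matrix_matrix_mult])
      finally show ?thesis by (simp add: has_vector_derivative_def)
    qed
    then have "h r = h 0"
      using has_derivative_zero_unique[of UNIV h 0 r] by simp
    then show ?thesis by (simp add: h_def)
  qed
  have inv: "mexp ((-r) *\<^sub>R A) ** mexp (r *\<^sub>R A) = mat 1" for r
    using key[of r 0] by simp
  \<comment> \<open>Cancelling the factor with exponent \<open>-r\<close> needs its inverse, which
    is the case \<open>t = 0\<close> of \<open>key\<close> taken at \<open>-r\<close>.\<close>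
  have "mexp (r *\<^sub>R A) ** (mexp ((-r) *\<^sub>R A) ** mexp ((r + t) *\<^sub>R A)) = mexp ((r + t) *\<^sub>R A)"
    using inv[of "-r"] by (simp add: matrix_mul_assoc)
  then show ?thesis by (simp only: key)
qed

section \<open>Covariance matrices and Gaussian densities\<close>

text \<open>This is t K(t), without the division that is meaningless at t = 0. Because the kernel
  has 1/4 in its exponent, it is half of the covariance matrix of the transition law.\<close>

definition covmat :: "real^'n^'n \<Rightarrow> real^'n^'n \<Rightarrow> real \<Rightarrow> real^'n^'n" where
  "covmat Q B t = integral {0..t} (\<lambda>r. mexp (r *\<^sub>R B) ** Q ** transpose (mexp (r *\<^sub>R B)))"

lemma covmat_integrand_continuous:
  "continuous_on S (\<lambda>r. mexp (r *\<^sub>R B) ** Q ** transpose (mexp (r *\<^sub>R B)))"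
  by (intro continuous_intros mexp_continuous_on)

text \<open>Split the integral at \<open>r\<close>, shift the second piece back to 0, and pull the
  constant conjugation out of it. Probabilistically: noise collected up to time \<open>t\<close> is
  transported by the flow for time \<open>r\<close> and fresh noise is added. This is the identity
  behind the semigroup law.\<close>

lemma covmat_add:
  assumes "0 \<le> r" "0 \<le> t"
  shows "covmat Q B (r + t) =
    covmat Q B r + mexp (r *\<^sub>R B) ** covmat Q B t ** transpose (mexp (r *\<^sub>R B))"
proof -
  define F where "F \<rho> = mexp (\<rho> *\<^sub>R B) ** Q ** transpose (mexp (\<rho> *\<^sub>R B))" for \<rho>
  define E where "E = mexp (r *\<^sub>R B)"
  have int: "F integrable_on {a..b}" for a b
    unfolding F_def by (intro integrable_continuous_real covmat_integrand_continuous)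
  have bl: "bounded_linear (\<lambda>M. E ** M ** transpose E)"
    by (intro bounded_linear_compose[OF bounded_bilinear.bounded_linear_left[OF bounded_bilinear_matrix_matrix_mult]
          bounded_bilinear.bounded_linear_right[OF bounded_bilinear_matrix_matrix_mult]])
  have shift: "F (r + x) = E ** F x ** transpose E" for x
    by (simp add: F_def E_def mexp_add matrix_transpose_mul matrix_mul_assoc)
  have "integral {0..r + t} F = integral {0..r} F + integral {0 + r..t + r} F"
    using Henstock_Kurzweil_Integration.integral_combine[OF _ _ int, of 0 r "r + t"] assms by (simp add: add.commute)
  also have "integral {0 + r..t + r} F = integral {0..t} ((\<lambda>M. E ** M ** transpose E) \<circ> F)"
    unfolding integral_shift_Icc_real[symmetric] by (simp add: o_def shift)
  also have "\<dots> = E ** integral {0..t} F ** transpose E"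
    by (rule integral_linear[OF int bl])
  finally show ?thesis by (simp add: covmat_def F_def[abs_def] E_def)
qed

lemma covmat_symmetric:
  assumes "transpose Q = Q"
  shows "transpose (covmat Q B t) = covmat Q B t"
proof -
  define F where "F \<rho> = mexp (\<rho> *\<^sub>R B) ** Q ** transpose (mexp (\<rho> *\<^sub>R B))" for \<rho>
  have int: "F integrable_on {0..t}"
    unfolding F_def by (intro integrable_continuous_real covmat_integrand_continuous)
  have "transpose \<circ> F = F"
    by (simp add: fun_eq_iff F_def matrix_transpose_mul assms matrix_mul_assoc)
  then show ?thesis
    using integral_linear[OF int bounded_linear_transpose] by (simp add: covmat_def F_def[abs_def])
qed

text \<open>The integrand is bounded on the compact interval [0, 1]. This linear rate in
  \<open>h\<close> is what makes the semigroup Lipschitz in time.\<close>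

lemma covmat_linear_bound:
  obtains c where "0 \<le> c" "\<And>h. 0 \<le> h \<Longrightarrow> h \<le> 1 \<Longrightarrow> norm (covmat Q B h) \<le> c * h"
proof -
  have "compact ((\<lambda>r. mexp (r *\<^sub>R B) ** Q ** transpose (mexp (r *\<^sub>R B))) ` {0..1})"
    by (intro compact_continuous_image covmat_integrand_continuous compact_Icc)
  from compact_imp_bounded[OF this] obtain c where c:
    "\<And>r. r \<in> {0..1} \<Longrightarrow> norm (mexp (r *\<^sub>R B) ** Q ** transpose (mexp (r *\<^sub>R B))) \<le> c"
    unfolding bounded_iff by blast
  show ?thesis
  proof
    show "0 \<le> c" using order_trans[OF norm_ge_zero c[of 0]] by simp
    show "norm (covmat Q B h) \<le> c * h" if "0 \<le> h" "h \<le> 1" for h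
      using integral_bound[OF that(1) covmat_integrand_continuous[of _ B Q], of c] c that
      by (simp add: covmat_def)
  qed
qed

section \<open>Factorisation of positive definite matrices\<close>

text \<open>Gram--Schmidt with respect to the inner product \<open>x \<bullet> (C *v y)\<close>.\<close>

lemma pos_def_factor:
  fixes C :: "real^'n^'n"
  assumes sym: "transpose C = C" and pd: "pos_def_mat C"
  obtains V :: "real^'n^'n" where "V ** C ** transpose V = mat 1"
proof -
  have sw: "x \<bullet> (C *v y) = y \<bullet> (C *v x)" for x y
    by (metis dot_lmul_matrix inner_commute sym transpose_matrix_vector)
  \<comment> \<open>The induction runs over finite index sets, since the index type carries no order
    along which to orthogonalise.\<close>
  have "\<exists>v :: 'n \<Rightarrow> real^'n. \<forall>i\<in>I. \<forall>j\<in>I. v i \<bullet> (C *v v j) = (if i = j then 1 else 0)"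
    if "finite I" for I
    using that
  proof (induction I rule: finite_induct)
    case (insert k I)
    then obtain v where v: "\<forall>i\<in>I. \<forall>j\<in>I. v i \<bullet> (C *v v j) = (if i = j then 1 else 0)"
      by blast
    \<comment> \<open>The vectors \<open>C *v v i\<close> are too few to span the space, so some
      nonzero \<open>x\<close> is orthogonal to all of them, that is, orthogonal to every
      \<open>v i\<close> in the inner product of \<open>C\<close>.\<close>
    have "dim ((\<lambda>i. C *v v i) ` I) \<le> card ((\<lambda>i. C *v v i) ` I)"
      using insert by (intro dim_le_card') auto
    also have "\<dots> \<le> card I" using insert by (simp add: card_image_le)
    also have "\<dots> < card (insert k I)" using insert by simp
    also have "\<dots> \<le> DIM(real^'n)" by (simp add: card_mono)
    finally obtain x where x: "x \<noteq> 0" "\<And>y. y \<in> span ((\<lambda>i. C *v v i) ` I) \<Longrightarrow> orthogonal x y"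
      using orthogonal_to_subspace_exists by blast
    have xC: "x \<bullet> (C *v v i) = 0" if "i \<in> I" for i
      using x(2)[of "C *v v i"] that by (simp add: orthogonal_def span_base)
    define a where "a = x \<bullet> (C *v x)"
    have a: "a > 0" using pd x(1) by (simp add: a_def pos_def_mat_def)
    define w where "w = (1 / sqrt a) *\<^sub>R x"
    have ww: "w \<bullet> (C *v w) = 1"
      using a by (simp add: w_def matrix_vector_mult_scaleR a_def[symmetric])
    have wv: "w \<bullet> (C *v v i) = 0" "v i \<bullet> (C *v w) = 0" if "i \<in> I" for i
      using xC[OF that] sw[of "v i" w] by (simp_all add: w_def)
    show ?case
    proof (intro exI[of _ "v(k := w)"] ballI)
      fix i j assume "i \<in> insert k I" "j \<in> insert k I"
      then show "(v(k := w)) i \<bullet> (C *v (v(k := w)) j) = (if i = j then 1 else 0)"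
        using v ww wv insert(2) by (cases "i = k"; cases "j = k") auto
    qed
  qed auto
  from this[OF finite_class.finite_UNIV]
  obtain v :: "'n \<Rightarrow> real^'n" where v: "\<And>i j. v i \<bullet> (C *v v j) = (if i = j then 1 else 0)"
    by auto
  have "(\<chi> i. v i) ** C ** transpose (\<chi> i. v i) = mat 1"
  proof -
    have "((\<chi> i. v i) ** C ** transpose (\<chi> i. v i)) $ i $ j = v i \<bullet> (C *v v j)" for i j
      unfolding matrix_mul_assoc[symmetric]
      by (simp add: matrix_matrix_mult_def transpose_def inner_vec_def matrix_vector_mult_def)
    then show ?thesis by (simp add: vec_eq_iff v mat_def)
  qed
  then show ?thesis by (rule that)
qed

text \<open>\<open>matrix_inv\<close> is a choice of a two-sided inverse; a one-sided inverse of a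
  square matrix is already two-sided, and that pins the choice down.\<close>

lemma matrix_inv_eqI:
  fixes A :: "real^'n^'n"
  assumes "A ** A' = mat 1"
  shows "matrix_inv A = A'"
proof -
  have "A ** A' = mat 1 \<and> A' ** A = mat 1"
    using assms matrix_left_right_inverse1 by blast
  then have "matrix_inv A ** A = mat 1"
    unfolding matrix_inv_def by (rule someI2) simp
  then have "matrix_inv A ** (A ** A') = A'"
    by (simp add: matrix_mul_assoc)
  then show ?thesis
    by (simp add: assms)
qed

text \<open>\<open>V\<close> is a whitening matrix and \<open>S\<close> its inverse: substituting z
  = V y turns the quadratic form of \<open>matrix_inv C\<close> into the squared norm of z, and the
  Jacobian is exactly the determinant factor of the density.\<close>

lemma pos_def_factor':
  fixes C :: "real^'n^'n"
  assumes sym: "transpose C = C" and pd: "pos_def_mat C"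
  obtains V S :: "real^'n^'n" where "V ** S = mat 1" "S ** V = mat 1" "C = S ** transpose S"
    "matrix_inv C = transpose V ** V" "det V \<noteq> 0" "det C powr (- (1/2)) = \<bar>det V\<bar>"
    "C ** matrix_inv C = mat 1"
proof -
  obtain V :: "real^'n^'n" where V: "V ** C ** transpose V = mat 1" using pos_def_factor[OF assms] .
  define S where "S = C ** transpose V"
  have VS: "V ** S = mat 1" using V by (simp add: S_def matrix_mul_assoc)
  then have SV: "S ** V = mat 1" by (rule matrix_left_right_inverse1)
  have "transpose V ** (V ** C) = mat 1"
    using V by (rule matrix_left_right_inverse1)
  then have "(transpose V ** V) ** C = mat 1"
    by (simp add: matrix_mul_assoc)
  then have inv: "C ** (transpose V ** V) = mat 1"
    by (rule matrix_left_right_inverse1)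
  have "transpose V ** transpose S = mat 1"
    by (metis SV matrix_transpose_mul transpose_mat)
  then have C: "C = S ** transpose S"
    by (metis S_def matrix_mul_assoc matrix_mul_rid)
  have d: "det V * det C * det V = 1"
    using arg_cong[OF V, of det] by (simp add: det_mul)
  then have d0: "det V \<noteq> 0" by auto
  have "det C = \<bar>det V\<bar> powr (-2)"
    using d d0 by (simp add: powr_minus powr_realpow[of "\<bar>det V\<bar>" 2, simplified] field_simps power2_eq_square)
  then have "det C powr (- (1/2)) = \<bar>det V\<bar>"
    using d0 by (simp add: powr_powr)
  with VS SV C d0 inv matrix_inv_eqI[OF inv] show ?thesis
    using that by metis
qed

section \<open>Linear change of variables for Lebesgue measure\<close>

lemma measurable_matrix_vector_mult [measurable]:
  "(*v) (V :: real^'n^'m) \<in> borel_measurable borel"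
  by (intro borel_measurable_continuous_onI continuous_intros)

text \<open>Lebesgue measure is determined by its values on boxes; the preimage of a box is the box
  with permuted sides, whose volume is the same product in another order.\<close>

lemma nn_integral_permute_coordinates:
  fixes F :: "real^'n \<Rightarrow> ennreal"
  assumes [measurable]: "F \<in> borel_measurable borel" and \<sigma>: "bij (\<sigma> :: 'n \<Rightarrow> 'n)"
  shows "(\<integral>\<^sup>+y. F (\<chi> i. y $ \<sigma> i) \<partial>lborel) = (\<integral>\<^sup>+z. F z \<partial>lborel)"
proof -
  have [measurable]: "(\<lambda>y :: real^'n. \<chi> i. y $ \<sigma> i) \<in> borel_measurable borel"
    by (intro borel_measurable_continuous_onI continuous_intros)
  have "lborel = distr lborel borel (\<lambda>y :: real^'n. \<chi> i. y $ \<sigma> i)"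
  proof (rule lborel_eqI)
    fix l u :: "real^'n"
    assume le: "\<And>b. b \<in> Basis \<Longrightarrow> l \<bullet> b \<le> u \<bullet> b"
    have le': "l $ i \<le> u $ i" for i
      using le[of "axis i 1"] by (auto simp: Basis_vec_def inner_axis)
    let ?l = "\<chi> i. l $ (inv \<sigma> i)" and ?u = "\<chi> i. u $ (inv \<sigma> i)"
    have cart: "(\<Prod>b\<in>Basis. (u - l) \<bullet> b) = (\<Prod>i\<in>UNIV. u $ i - l $ i)" for u l :: "real^'n"
    proof -
      have "Basis = range (\<lambda>i :: 'n. axis i (1::real))" by (auto simp: Basis_vec_def)
      show ?thesis
        unfolding \<open>Basis = _\<close> by (simp add: prod.reindex inj_on_def axis_eq_axis inner_axis)
    qed
    have pre: "(\<lambda>y :: real^'n. \<chi> i. y $ \<sigma> i) -` box l u = box ?l ?u"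
    proof -
      have "(\<forall>i. l $ i < y $ \<sigma> i \<and> y $ \<sigma> i < u $ i) \<longleftrightarrow>
          (\<forall>i. l $ inv \<sigma> i < y $ i \<and> y $ i < u $ inv \<sigma> i)" for y :: "real^'n"
      proof -
        have "\<sigma> (inv \<sigma> i) = i" "inv \<sigma> (\<sigma> i) = i" for i
          using \<sigma> by (simp_all add: bij_is_surj surj_f_inv_f bij_is_inj)
        then show ?thesis by metis
      qed
      then show ?thesis by (auto simp: mem_box_cart)
    qed
    have "emeasure (distr lborel borel (\<lambda>y :: real^'n. \<chi> i. y $ \<sigma> i)) (box l u) = emeasure lborel (box ?l ?u)"
      by (simp add: emeasure_distr pre)
    also have "\<dots> = ennreal (\<Prod>b\<in>Basis. (?u - ?l) \<bullet> b)"
      by (rule emeasure_lborel_box) (use le' in \<open>auto simp: Basis_vec_def inner_axis\<close>)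
    also have "(\<Prod>b\<in>Basis. (?u - ?l) \<bullet> b) = (\<Prod>i\<in>UNIV. u $ (inv \<sigma> i) - l $ (inv \<sigma> i))"
      by (simp only: cart) simp
    also have "\<dots> = (\<Prod>i\<in>UNIV. u $ i - l $ i)"
      using bij_imp_bij_inv[OF \<sigma>]
      by (intro prod.reindex_bij_betw[where g = "\<lambda>i. u $ i - l $ i"])
    also have "\<dots> = (\<Prod>b\<in>Basis. (u - l) \<bullet> b)" by (simp only: cart)
    finally show "emeasure (distr lborel borel (\<lambda>y :: real^'n. \<chi> i. y $ \<sigma> i)) (box l u)
       = ennreal (\<Prod>b\<in>Basis. (u - l) \<bullet> b)" .
  qed simp
  then have "(\<integral>\<^sup>+z. F z \<partial>lborel) = (\<integral>\<^sup>+z. F z \<partial>distr lborel borel (\<lambda>y :: real^'n. \<chi> i. y $ \<sigma> i))"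
    by simp
  then show ?thesis by (simp add: nn_integral_distr)
qed

text \<open>View Lebesgue measure as a product and integrate over the \<open>m\<close>-th coordinate
  first. With the other coordinates fixed, the shear is a translation in that coordinate, by an
  amount depending only on the \<open>n\<close>-th one.\<close>

lemma nn_integral_shear:
  fixes F :: "real^'n \<Rightarrow> ennreal"
  assumes [measurable]: "F \<in> borel_measurable borel" and "m \<noteq> n"
  shows "(\<integral>\<^sup>+y. F (y + (c * y $ n) *\<^sub>R axis m 1) \<partial>lborel) = (\<integral>\<^sup>+z. F z \<partial>lborel)"
proof -
  define e where "e = (axis m 1 :: real^'n)"
  define I where "I = Basis - {e}"
  have e: "e \<in> Basis" by (auto simp: e_def Basis_vec_def)
  have n: "axis n 1 \<in> I" using assms(2) by (auto simp: I_def e_def Basis_vec_def axis_eq_axis)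
  have B: "Basis = insert e I" "finite I" "e \<notin> I" using e by (auto simp: I_def)
  interpret product_sigma_finite "\<lambda>_ :: real^'n. lborel :: real measure" ..
  define L where "L x = (\<Sum>b\<in>I. x b *\<^sub>R b)" for x :: "real^'n \<Rightarrow> real"
  have split: "(\<Sum>b\<in>Basis. (x(e := y)) b *\<^sub>R b) = L x + y *\<^sub>R e" for x y
  proof -
    have "(\<Sum>b\<in>I. (x(e := y)) b *\<^sub>R b) = L x"
      unfolding L_def by (rule sum.cong) (use B in auto)
    then show ?thesis
      unfolding B(1) sum.insert[OF B(2,3)] by (simp add: add.commute)
  qed
  have comp: "(\<Sum>b\<in>Basis. (x(e := y)) b *\<^sub>R b) $ n = x (axis n 1)" for x y
  proof -
    have "(\<Sum>b\<in>Basis. (x(e := y)) b *\<^sub>R b) $ n = (\<Sum>b\<in>Basis. (x(e := y)) b *\<^sub>R b) \<bullet> axis n 1"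
      by (simp add: inner_axis)
    also have "\<dots> = (x(e := y)) (axis n 1)"
      by (rule inner_sum_left_Basis) (auto simp: Basis_vec_def)
    finally show ?thesis using n B by auto
  qed
  have ins: "(\<integral>\<^sup>+z. H z \<partial>lborel) = (\<integral>\<^sup>+x. (\<integral>\<^sup>+y. H (\<Sum>b\<in>Basis. (x(e := y)) b *\<^sub>R b) \<partial>lborel) \<partial>Pi\<^sub>M I (\<lambda>_. lborel))"
    if [measurable]: "H \<in> borel_measurable borel" for H :: "real^'n \<Rightarrow> ennreal"
  proof -
    have "(\<integral>\<^sup>+z. H z \<partial>lborel) = (\<integral>\<^sup>+f. H (\<Sum>b\<in>Basis. f b *\<^sub>R b) \<partial>Pi\<^sub>M Basis (\<lambda>_. lborel))"
      by (subst lborel_eq) (subst nn_integral_distr, simp_all)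
    also have "\<dots> = (\<integral>\<^sup>+f. H (\<Sum>b\<in>Basis. f b *\<^sub>R b) \<partial>Pi\<^sub>M (insert e I) (\<lambda>_. lborel))"
      using B(1) by simp
    also have "\<dots> = (\<integral>\<^sup>+x. (\<integral>\<^sup>+y. H (\<Sum>b\<in>Basis. (x(e := y)) b *\<^sub>R b) \<partial>lborel) \<partial>Pi\<^sub>M I (\<lambda>_. lborel))"
      by (rule product_nn_integral_insert) (use B(2,3) in \<open>simp_all flip: B(1)\<close>)
    finally show ?thesis .
  qed
  have arg: "(\<Sum>b\<in>Basis. (x(e := y)) b *\<^sub>R b)
      + (c * (\<Sum>b\<in>Basis. (x(e := y)) b *\<^sub>R b) $ n) *\<^sub>R axis m 1
      = L x + (c * x (axis n 1) + 1 * y) *\<^sub>R e" for x y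
    unfolding comp unfolding split by (simp add: e_def algebra_simps)
  have "(\<integral>\<^sup>+y. F (y + (c * y $ n) *\<^sub>R axis m 1) \<partial>lborel)
      = (\<integral>\<^sup>+x. (\<integral>\<^sup>+y. F (L x + (c * x (axis n 1) + 1 * y) *\<^sub>R e) \<partial>lborel) \<partial>Pi\<^sub>M I (\<lambda>_. lborel))"
    by (subst ins) (simp_all only: arg, simp)
  also have "\<dots> = (\<integral>\<^sup>+x. (\<integral>\<^sup>+y. F (L x + y *\<^sub>R e) \<partial>lborel) \<partial>Pi\<^sub>M I (\<lambda>_. lborel))"
  proof (rule nn_integral_cong)
    fix x :: "real^'n \<Rightarrow> real"
    show "(\<integral>\<^sup>+y. F (L x + (c * x (axis n 1) + 1 * y) *\<^sub>R e) \<partial>lborel) = (\<integral>\<^sup>+y. F (L x + y *\<^sub>R e) \<partial>lborel)"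
      using nn_integral_real_affine[of "\<lambda>y. F (L x + y *\<^sub>R e)" 1 "c * x (axis n 1)"] by simp
  qed
  also have "\<dots> = (\<integral>\<^sup>+z. F z \<partial>lborel)"
    by (subst ins[of F]) (simp_all only: split assms(1))
  finally show ?thesis .
qed

lemma nn_integral_diagonal:
  fixes F :: "real^'n \<Rightarrow> ennreal" and A :: "real^'n^'n"
  assumes [measurable]: "F \<in> borel_measurable borel"
    and A: "\<And>i j. i \<noteq> j \<Longrightarrow> A $ i $ j = 0" and "det A \<noteq> 0"
  shows "(\<integral>\<^sup>+y. ennreal \<bar>det A\<bar> * F (A *v y) \<partial>lborel) = (\<integral>\<^sup>+z. F z \<partial>lborel)"
proof -
  define c where "c b = b \<bullet> (A *v b)" for b
  have dd: "det A = (\<Prod>i\<in>UNIV. A $ i $ i)" by (rule det_diagonal[OF A])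
  have Av: "(A *v y) $ i = A $ i $ i * y $ i" for i y
  proof -
    have "(A *v y) $ i = (\<Sum>j\<in>UNIV. if j = i then A $ i $ i * y $ i else 0)"
      unfolding matrix_vector_mult_def vec_lambda_beta by (intro sum.cong) (use A in auto)
    then show ?thesis by simp
  qed
  have ca: "c (axis i 1) = A $ i $ i" for i
    by (simp add: c_def inner_axis' Av)
  have nz: "c b \<noteq> 0" if "b \<in> Basis" for b
    using that assms(3) by (auto simp: dd Basis_vec_def ca)
  have T: "0 + (\<Sum>j\<in>Basis. (c j * (y \<bullet> j)) *\<^sub>R j) = A *v y" for y
  proof (rule euclidean_eqI)
    fix b :: "real^'n" assume b: "b \<in> Basis"
    then obtain i where i: "b = axis i 1" by (auto simp: Basis_vec_def)
    have "(0 + (\<Sum>j\<in>Basis. (c j * (y \<bullet> j)) *\<^sub>R j)) \<bullet> b = c b * (y \<bullet> b)"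
      using b by (simp only: add_0 inner_sum_left_Basis)
    also have "\<dots> = (A *v y) \<bullet> b" by (simp add: i ca Av inner_axis)
    finally show "(0 + (\<Sum>j\<in>Basis. (c j * (y \<bullet> j)) *\<^sub>R j)) \<bullet> b = (A *v y) \<bullet> b" .
  qed
  have "Basis = range (\<lambda>i :: 'n. axis i (1::real))" by (auto simp: Basis_vec_def)
  have "(\<Prod>b\<in>Basis. \<bar>c b\<bar>) = \<bar>det A\<bar>"
    unfolding \<open>Basis = _\<close> by (simp add: prod.reindex inj_on_def axis_eq_axis ca dd abs_prod)
  then have "lborel = density (distr lborel borel ((*v) A)) (\<lambda>_. ennreal \<bar>det A\<bar>)"
    using lborel_affine_euclidean[of c 0, OF nz] by (simp only: T)
  then have "(\<integral>\<^sup>+z. F z \<partial>lborel) = (\<integral>\<^sup>+z. F z \<partial>density (distr lborel borel ((*v) A)) (\<lambda>_. ennreal \<bar>det A\<bar>))"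
    by simp
  then show ?thesis by (simp add: nn_integral_density nn_integral_distr)
qed

text \<open>The library's change of variables requires a well-ordered index type, hence the detour
  through elementary matrices.\<close>

lemma nn_integral_linear_image:
  fixes V :: "real^'n^'n"
  assumes "det V \<noteq> 0" and "F \<in> borel_measurable borel"
  shows "(\<integral>\<^sup>+y. ennreal \<bar>det V\<bar> * F (V *v y) \<partial>lborel) = (\<integral>\<^sup>+z. F z \<partial>lborel)"
proof -
  \<comment> \<open>\<open>F\<close> is quantified inside the induction because, for a product, the
    hypothesis for \<open>B\<close> is applied to the integrand composed with
    \<open>A\<close>.\<close>
  have "det V \<noteq> 0 \<longrightarrow> (\<forall>F. F \<in> borel_measurable borel \<longrightarrow>
    (\<integral>\<^sup>+y. ennreal \<bar>det V\<bar> * F (V *v y) \<partial>lborel) = (\<integral>\<^sup>+z. F z \<partial>lborel))" (is "?P V")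
  proof (induction V rule: induct_matrix_elementary)
    case (1 A B)
    show ?case
    proof (intro impI allI)
      fix F :: "real^'n \<Rightarrow> ennreal"
      assume d: "det (A ** B) \<noteq> 0" and [measurable]: "F \<in> borel_measurable borel"
      then have dA: "det A \<noteq> 0" and dB: "det B \<noteq> 0" by (auto simp: det_mul)
      have "(\<integral>\<^sup>+y. ennreal \<bar>det (A ** B)\<bar> * F ((A ** B) *v y) \<partial>lborel)
          = (\<integral>\<^sup>+y. ennreal \<bar>det B\<bar> * (ennreal \<bar>det A\<bar> * F (A *v (B *v y))) \<partial>lborel)"
        by (simp add: det_mul abs_mult ennreal_mult' matrix_vector_mul_assoc mult_ac)
      also have "\<dots> = (\<integral>\<^sup>+y. ennreal \<bar>det A\<bar> * F (A *v y) \<partial>lborel)"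
        using 1(2)[rule_format, OF dB, of "\<lambda>y. ennreal \<bar>det A\<bar> * F (A *v y)"] by simp
      also have "\<dots> = (\<integral>\<^sup>+z. F z \<partial>lborel)"
        using 1(1)[rule_format, OF dA, of F] by simp
      finally show "(\<integral>\<^sup>+y. ennreal \<bar>det (A ** B)\<bar> * F ((A ** B) *v y) \<partial>lborel) = (\<integral>\<^sup>+z. F z \<partial>lborel)" .
    qed
  next
    \<comment> \<open>A zero row forces the determinant to vanish, so the implication is
      vacuous.\<close>
    case (2 A i)
    then show ?case using det_zero_row by blast
  next
    case (3 A)
    then show ?case using nn_integral_diagonal by blast
  next
    case (4 m n)
    let ?\<sigma> = "Transposition.transpose m n"
    let ?V = "\<chi> i j. mat 1 $ i $ ?\<sigma> j :: real^'n^'n"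
    have d: "\<bar>det ?V\<bar> = 1"
      by (simp add: det_permute_columns permutes_swap_id sign_swap_id abs_mult)
    have V: "?V *v y = (\<chi> i. y $ ?\<sigma> i)" for y
    proof -
      have "(?V *v y) $ i = (\<Sum>j\<in>UNIV. if j = ?\<sigma> i then y $ j else 0)" for i
        unfolding matrix_vector_mult_def vec_lambda_beta
        by (intro sum.cong refl) (auto simp: mat_def)
      then show ?thesis by (simp add: vec_eq_iff)
    qed
    show ?case
      unfolding d V by (auto simp: nn_integral_permute_coordinates)
  next
    case (5 m n c)
    let ?V = "\<chi> i j. if i = m \<and> j = n then c else of_bool (i = j) :: real^'n^'n"
    have "?V = (\<chi> k. if k = m then row m (mat 1) + c *s row n (mat 1) else row k (mat 1))"
      using 5 by (auto simp: vec_eq_iff row_def mat_def)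
    then have d: "det ?V = 1"
      using det_row_operation[OF 5, of "mat 1" c] by simp
    have V: "?V *v y = y + (c * y $ n) *\<^sub>R axis m 1" for y
    proof -
      have "(?V *v y) $ i = (\<Sum>j\<in>UNIV. (if j = i then y $ j else 0) + (if j = n then (if i = m then c * y $ j else 0) else 0))" for i
        unfolding matrix_vector_mult_def vec_lambda_beta
        by (intro sum.cong refl) (use 5 in auto)
      then show ?thesis by (simp add: vec_eq_iff sum.distrib axis_def)
    qed
    show ?case
      unfolding d V by (auto simp: nn_integral_shear[OF _ 5])
  qed
  with assms show ?thesis by blast
qed

text \<open>The density factors into one-dimensional normal densities. The width is left free for
  two uses: \<open>sqrt 2\<close> gives the exponent -|z|^2/4 of the heat kernel, and 2 gives the
  wider Gaussian that dominates second moments.\<close>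

lemma nn_integral_gaussian_product:
  assumes "0 < \<sigma>"
  shows "(\<integral>\<^sup>+z. ennreal ((2 * pi * \<sigma>\<^sup>2) powr (- real CARD('n) / 2) * exp (- (norm z)\<^sup>2 / (2 * \<sigma>\<^sup>2)))
      \<partial>(lborel :: (real^'n) measure)) = 1"
proof -
  have e: "(2 * pi * \<sigma>\<^sup>2) powr (- real CARD('n) / 2) * exp (- (norm z)\<^sup>2 / (2 * \<sigma>\<^sup>2))
     = (\<Prod>b\<in>Basis. normal_density 0 \<sigma> (z \<bullet> b))" for z :: "real^'n"
  proof -
    have "(2 * pi * \<sigma>\<^sup>2) powr (- real CARD('n) / 2) = (1 / sqrt (2 * pi * \<sigma>\<^sup>2)) ^ CARD('n)"
    proof -
      have "(1 / sqrt (2 * pi * \<sigma>\<^sup>2)) ^ CARD('n)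
          = ((2 * pi * \<sigma>\<^sup>2) powr (- (1 / 2))) powr real CARD('n)"
        using assms by (subst powr_realpow) (simp_all add: powr_minus_divide powr_half_sqrt)
      also have "\<dots> = (2 * pi * \<sigma>\<^sup>2) powr (- real CARD('n) / 2)"
        unfolding powr_powr by simp
      finally show ?thesis by simp
    qed
    moreover have "exp (- (norm z)\<^sup>2 / (2 * \<sigma>\<^sup>2)) = (\<Prod>b\<in>Basis. exp (- (z \<bullet> b)\<^sup>2 / (2 * \<sigma>\<^sup>2)))"
      unfolding power2_norm_eq_inner euclidean_inner[of z z]
      by (simp add: exp_sum[symmetric] sum_negf sum_divide_distrib power2_eq_square)
    ultimately show ?thesis
      unfolding normal_density_def prod.distrib by simp
  qed
  have "(\<integral>\<^sup>+x. ennreal (normal_density 0 \<sigma> x) \<partial>lborel) = 1"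
    using nn_integral_eq_integral[OF integrable_normal_density[OF assms, of 0]]
    by (simp add: assms)
  moreover have "(\<integral>\<^sup>+z. (\<Prod>b\<in>Basis. ennreal (normal_density 0 \<sigma> (z \<bullet> b))) \<partial>(lborel :: (real^'n) measure))
      = (\<Prod>b\<in>(Basis :: (real^'n) set). \<integral>\<^sup>+x. ennreal (normal_density 0 \<sigma> x) \<partial>lborel)"
    by (rule nn_integral_lborel_prod) simp_all
  ultimately show ?thesis
    unfolding e by (simp add: prod_ennreal)
qed

text \<open>The centred Gaussian density of covariance 2 C, in heat kernel normalisation.\<close>

definition gauss_dens :: "real^'n^'n \<Rightarrow> real^'n \<Rightarrow> real" where
  "gauss_dens C y = (4 * pi) powr (- real CARD('n) / 2) * det C powr (-1/2)
     * exp (- ((matrix_inv C *v y) \<bullet> y) / 4)"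

lemma gauss_dens_nonneg: "0 \<le> gauss_dens C y"
  by (simp add: gauss_dens_def)

lemma gauss_dens_even: "gauss_dens C (- y) = gauss_dens C y"
  by (simp add: gauss_dens_def bounded_bilinear.minus_right[OF bounded_bilinear_matrix_vector_mult])

lemma gauss_dens_continuous: "continuous_on S (gauss_dens C)"
  unfolding gauss_dens_def by (intro continuous_intros) auto

lemma gauss_dens_measurable [measurable]: "gauss_dens C \<in> borel_measurable borel"
  by (intro borel_measurable_continuous_onI gauss_dens_continuous)

lemma inner_transpose_mult_self:
  "((transpose V ** V) *v y) \<bullet> y = (norm (V *v y :: real^'n))\<^sup>2"
  unfolding matrix_vector_mul_assoc[symmetric] transpose_matrix_vector dot_lmul_matrix power2_norm_eq_inner ..

text \<open>With the whitening substitution z = V y, the factor \<open>det C powr (-1/2)\<close>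
  equals the Jacobian, which leaves the standard Gaussian of width \<open>sqrt 2\<close>.\<close>

lemma nn_integral_gauss_dens:
  assumes "transpose C = C" "pos_def_mat C"
  shows "(\<integral>\<^sup>+y. ennreal (gauss_dens C y) \<partial>lborel) = 1"
proof -
  obtain V where V: "det V \<noteq> 0" "matrix_inv C = transpose V ** V" "det C powr (- (1/2)) = \<bar>det V\<bar>"
    using pos_def_factor'[OF assms] by metis
  have "(\<integral>\<^sup>+y. ennreal (gauss_dens C y) \<partial>lborel) =
     (\<integral>\<^sup>+y. ennreal \<bar>det V\<bar> * ennreal ((4 * pi) powr (- real CARD('a) / 2) * exp (- (norm (V *v y))\<^sup>2 / 4)) \<partial>lborel)"
    by (simp add: gauss_dens_def V inner_transpose_mult_self mult_ac flip: ennreal_mult')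
  also have "\<dots> = 1"
    using nn_integral_gaussian_product[of "sqrt 2", where 'n = 'a]
    by (subst nn_integral_linear_image[OF V(1)]) simp_all
  finally show ?thesis .
qed

section \<open>Convolution and second moments of Gaussian densities\<close>

lemma inner_matrix_symmetric:
  fixes A :: "real^'n^'n"
  assumes "transpose A = A"
  shows "(A *v x) \<bullet> y = x \<bullet> (A *v y)"
proof -
  have "(transpose A *v x) \<bullet> y = x \<bullet> (A *v y)"
    unfolding transpose_matrix_vector dot_lmul_matrix ..
  then show ?thesis by (simp add: assms)
qed

lemma nn_integral_lborel_shift:
  fixes F :: "'a::euclidean_space \<Rightarrow> ennreal"
  assumes [measurable]: "F \<in> borel_measurable borel"
  shows "(\<integral>\<^sup>+y. F (c + y) \<partial>lborel) = (\<integral>\<^sup>+z. F z \<partial>lborel)"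
proof -
  have "(\<integral>\<^sup>+z. F z \<partial>lborel) = (\<integral>\<^sup>+z. F z \<partial>distr lborel borel ((+) c))"
    by (simp only: lborel_distr_plus)
  then show ?thesis by (simp add: nn_integral_distr)
qed

lemma gauss_dens_affine_measurable [measurable]:
  "(\<lambda>y. gauss_dens C (a - E *v y)) \<in> borel_measurable borel"
  by (rule measurable_compose[OF _ gauss_dens_measurable]) measurable

lemma matrix_inv_covariance:
  fixes C :: "real^'n^'n"
  assumes "transpose C = C" "pos_def_mat C"
  shows "transpose (matrix_inv C) = matrix_inv C" "C ** matrix_inv C = mat 1" "matrix_inv C ** C = mat 1"
proof -
  obtain V :: "real^'n^'n" where V: "matrix_inv C = transpose V ** V" and *: "C ** matrix_inv C = mat 1"
    using pos_def_factor'[OF assms] by metis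
  show "transpose (matrix_inv C) = matrix_inv C" unfolding V by (simp add: matrix_transpose_mul)
  show "C ** matrix_inv C = mat 1" by (rule *)
  then show "matrix_inv C ** C = mat 1" by (rule matrix_left_right_inverse1)
qed

text \<open>Completing the square in \<open>W\<close>: the minimiser of the joint exponent is
  \<open>C1 *v (transpose E *v (matrix_inv C3 *v y))\<close>.\<close>

lemma gaussian_exponent_complete_square:
  fixes C1 C2 C3 E :: "real^'n^'n"
  assumes C1: "transpose C1 = C1" "pos_def_mat C1"
    and C2: "transpose C2 = C2" "pos_def_mat C2"
    and C3: "transpose C3 = C3" "pos_def_mat C3"
    and eq: "C3 = C2 + E ** C1 ** transpose E"
  defines "W0 \<equiv> \<lambda>y. C1 *v (transpose E *v (matrix_inv C3 *v y))"
  shows "(matrix_inv C1 *v (W0 y + U)) \<bullet> (W0 y + U)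
      + (matrix_inv C2 *v (y - E *v (W0 y + U))) \<bullet> (y - E *v (W0 y + U))
    = (matrix_inv C1 *v U) \<bullet> U + (matrix_inv C2 *v (E *v U)) \<bullet> (E *v U)
      + (matrix_inv C3 *v y) \<bullet> y"
proof -
  note I1 = matrix_inv_covariance[OF C1] and I2 = matrix_inv_covariance[OF C2]
    and I3 = matrix_inv_covariance[OF C3]
  define c where "c = matrix_inv C3 *v y"
  define d where "d = transpose E *v c"
  have W0: "W0 y = C1 *v d" by (simp add: W0_def c_def d_def)
  have A1: "matrix_inv C1 *v W0 y = d" by (simp add: W0 matrix_vector_mul_assoc I1)
  have "y = C3 *v c" by (simp add: c_def matrix_vector_mul_assoc I3)
  \<comment> \<open>Applying \<open>C3 = C2 + E ** C1 ** transpose E\<close> to \<open>c\<close>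
    splits \<open>y\<close> into a noise part \<open>C2 *v c\<close> and a transported part; hence
    both quadratic forms have gradients expressed by the same vector \<open>c\<close>.\<close>
  also have "\<dots> = C2 *v c + E *v W0 y"
    by (simp add: eq W0 d_def matrix_vector_mult_add_rdistrib matrix_vector_mul_assoc
        matrix_mul_assoc del: transpose_matrix_vector)
  finally have y2: "y - E *v W0 y = C2 *v c" by (simp add: algebra_simps)
  define y2 where "y2 = y - E *v W0 y"
  have A2: "matrix_inv C2 *v y2 = c" by (simp add: y2_def y2 matrix_vector_mul_assoc I2)
  have Ud: "d \<bullet> U = c \<bullet> (E *v U)" for U
    unfolding d_def transpose_matrix_vector dot_lmul_matrix ..
  \<comment> \<open>The terms linear in \<open>U\<close> are 2 (c, E U) here and its negative in the
    second form. Their cancellation is the criticality of \<open>W0 y\<close>.\<close>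
  have 1: "(matrix_inv C1 *v (W0 y + U)) \<bullet> (W0 y + U)
      = d \<bullet> W0 y + 2 * (c \<bullet> (E *v U)) + (matrix_inv C1 *v U) \<bullet> U"
    using inner_matrix_symmetric[OF I1(1), of U "W0 y"]
    by (simp add: matrix_vector_right_distrib inner_add_left inner_add_right A1 Ud inner_commute[of U d])
  have sub: "y - E *v (W0 y + U) = y2 - E *v U"
    by (simp add: y2_def matrix_vector_right_distrib)
  have 2: "(matrix_inv C2 *v (y2 - E *v U)) \<bullet> (y2 - E *v U)
      = c \<bullet> y2 - 2 * (c \<bullet> (E *v U)) + (matrix_inv C2 *v (E *v U)) \<bullet> (E *v U)"
    using inner_matrix_symmetric[OF I2(1), of "E *v U" y2]
    by (simp add: matrix_vector_mult_diff_distrib inner_diff_left inner_diff_right A2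
        inner_commute[of "E *v U" c])
  have 3: "d \<bullet> W0 y + c \<bullet> y2 = c \<bullet> y"
    by (simp add: Ud y2_def inner_diff_right)
  show ?thesis
    unfolding sub 1 2 using 3 by (simp add: c_def)
qed

text \<open>Completing the square gives the convolution up to a constant, which is determined by
  the normalisation of the three densities.\<close>

lemma gauss_dens_convolution:
  fixes C1 C2 C3 E :: "real^'n^'n"
  assumes C1: "transpose C1 = C1" "pos_def_mat C1"
    and C2: "transpose C2 = C2" "pos_def_mat C2"
    and C3: "transpose C3 = C3" "pos_def_mat C3"
    and eq: "C3 = C2 + E ** C1 ** transpose E"
  shows "(\<integral>\<^sup>+W. ennreal (gauss_dens C1 W * gauss_dens C2 (y - E *v W)) \<partial>lborel)
    = ennreal (gauss_dens C3 y)"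
proof -
  define k where "k C = (4 * pi) powr (- real CARD('n) / 2) * det C powr (-1/2)" for C :: "real^'n^'n"
  define e where "e C y = exp (- ((matrix_inv C *v y) \<bullet> y) / 4)" for C :: "real^'n^'n" and y
  have g: "gauss_dens C y = k C * e C y" for C :: "real^'n^'n" and y
    by (simp add: gauss_dens_def k_def e_def)
  have k0: "0 \<le> k C" for C by (simp add: k_def)
  define W0 where "W0 y = C1 *v (transpose E *v (matrix_inv C3 *v y))" for y
  \<comment> \<open>The unknown constant is the convolution at 0, taken in \<open>ennreal\<close> so
    that its finiteness need not be known beforehand.\<close>
  define \<kappa> where "\<kappa> = (\<integral>\<^sup>+U. ennreal (gauss_dens C1 U * gauss_dens C2 (0 - E *v U)) \<partial>lborel)"
  have conv: "(\<integral>\<^sup>+W. ennreal (gauss_dens C1 W * gauss_dens C2 (y - E *v W)) \<partial>lborel)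
      = \<kappa> * ennreal (e C3 y)" for y
  proof -
    have ee: "e C1 (W0 y + U) * e C2 (y - E *v (W0 y + U)) = e C1 U * e C2 (0 - E *v U) * e C3 y" for U
    proof -
      have "- ((matrix_inv C1 *v (W0 y + U)) \<bullet> (W0 y + U)) / 4
          + - ((matrix_inv C2 *v (y - E *v (W0 y + U))) \<bullet> (y - E *v (W0 y + U))) / 4
          = - ((matrix_inv C1 *v U) \<bullet> U) / 4 + - ((matrix_inv C2 *v (0 - E *v U)) \<bullet> (0 - E *v U)) / 4
            + - ((matrix_inv C3 *v y) \<bullet> y) / 4"
        using gaussian_exponent_complete_square[OF assms, of y U] unfolding W0_def
        by (simp add: bounded_bilinear.minus_right[OF bounded_bilinear_matrix_vector_mult])
      then show ?thesis unfolding e_def mult_exp_exp by simp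
    qed
    have "(\<integral>\<^sup>+W. ennreal (gauss_dens C1 W * gauss_dens C2 (y - E *v W)) \<partial>lborel)
        = (\<integral>\<^sup>+U. ennreal (gauss_dens C1 (W0 y + U) * gauss_dens C2 (y - E *v (W0 y + U))) \<partial>lborel)"
      by (rule nn_integral_lborel_shift[symmetric]) measurable
    also have "\<dots> = (\<integral>\<^sup>+U. ennreal (gauss_dens C1 U * gauss_dens C2 (0 - E *v U)) * ennreal (e C3 y) \<partial>lborel)"
    proof (rule nn_integral_cong)
      fix U
      have "gauss_dens C1 (W0 y + U) * gauss_dens C2 (y - E *v (W0 y + U))
          = k C1 * k C2 * (e C1 (W0 y + U) * e C2 (y - E *v (W0 y + U)))" by (simp only: g mult_ac)
      also have "\<dots> = gauss_dens C1 U * gauss_dens C2 (0 - E *v U) * e C3 y"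
        unfolding ee by (simp only: g mult_ac)
      finally show "ennreal (gauss_dens C1 (W0 y + U) * gauss_dens C2 (y - E *v (W0 y + U)))
          = ennreal (gauss_dens C1 U * gauss_dens C2 (0 - E *v U)) * ennreal (e C3 y)"
        by (simp only:) (rule ennreal_mult, simp_all add: e_def gauss_dens_nonneg)
    qed
    also have "\<dots> = \<kappa> * ennreal (e C3 y)"
      unfolding \<kappa>_def by (rule nn_integral_multc) measurable
    finally show ?thesis .
  qed
  have [measurable]: "e C3 \<in> borel_measurable borel"
    unfolding e_def by measurable
  have sh: "(\<integral>\<^sup>+y. ennreal (gauss_dens C2 (y - a)) \<partial>lborel) = 1" for a
    using nn_integral_lborel_shift[of "\<lambda>y. ennreal (gauss_dens C2 y)" "-a"] nn_integral_gauss_dens[OF C2]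
    by simp
  have [measurable]: "(\<lambda>p. gauss_dens C2 (fst p - E *v snd p)) \<in> borel_measurable (borel \<Otimes>\<^sub>M borel)"
    by (rule measurable_compose[OF _ gauss_dens_measurable]) measurable
  have "\<kappa> * (\<integral>\<^sup>+y. ennreal (e C3 y) \<partial>lborel)
      = (\<integral>\<^sup>+y. \<integral>\<^sup>+W. ennreal (gauss_dens C1 W * gauss_dens C2 (y - E *v W)) \<partial>lborel \<partial>lborel)"
    unfolding conv by (rule nn_integral_cmult[symmetric]) measurable
  also have "\<dots> = (\<integral>\<^sup>+W. \<integral>\<^sup>+y. ennreal (gauss_dens C1 W * gauss_dens C2 (y - E *v W)) \<partial>lborel \<partial>lborel)"
    by (rule lborel_pair.Fubini'[symmetric]) (simp add: case_prod_beta)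
  also have "\<dots> = (\<integral>\<^sup>+W. ennreal (gauss_dens C1 W) * (\<integral>\<^sup>+y. ennreal (gauss_dens C2 (y - E *v W)) \<partial>lborel) \<partial>lborel)"
    by (intro nn_integral_cong)
      (simp add: ennreal_mult gauss_dens_nonneg nn_integral_cmult measurable_compose[OF _ gauss_dens_measurable])
  also have "\<dots> = 1" by (simp add: sh nn_integral_gauss_dens[OF C1])
  finally have K1: "\<kappa> * (\<integral>\<^sup>+y. ennreal (e C3 y) \<partial>lborel) = 1" .
  have "1 = (\<integral>\<^sup>+y. ennreal (k C3) * ennreal (e C3 y) \<partial>lborel)"
    unfolding nn_integral_gauss_dens[OF C3, symmetric] g using k0
    by (intro nn_integral_cong) (simp add: ennreal_mult e_def)
  also have "\<dots> = ennreal (k C3) * (\<integral>\<^sup>+y. ennreal (e C3 y) \<partial>lborel)"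
    by (rule nn_integral_cmult) measurable
  finally have K3: "ennreal (k C3) * (\<integral>\<^sup>+y. ennreal (e C3 y) \<partial>lborel) = 1" by simp
  \<comment> \<open>Both \<open>\<kappa>\<close> and \<open>k C3\<close> give 1 when multiplied by
    the integral of \<open>e C3\<close>. They are identified by multiplying by 1, which avoids
    division in \<open>ennreal\<close>.\<close>
  have "\<kappa> = \<kappa> * (ennreal (k C3) * (\<integral>\<^sup>+y. ennreal (e C3 y) \<partial>lborel))" by (simp add: K3)
  also have "\<dots> = (\<kappa> * (\<integral>\<^sup>+y. ennreal (e C3 y) \<partial>lborel)) * ennreal (k C3)" by (simp add: mult_ac)
  finally have "\<kappa> = ennreal (k C3)" by (simp add: K1)
  then show ?thesis
    unfolding conv g[of C3] using k0 by (simp add: ennreal_mult e_def)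
qed

text \<open>Cauchy-Schwarz in each row; the norm of a matrix in this type is the Euclidean norm of
  its entries.\<close>

lemma norm_matrix_vector_mult_Frobenius:
  fixes S :: "real^'n^'m"
  shows "norm (S *v z) \<le> norm S * norm z"
proof -
  have "(norm (S *v z))\<^sup>2 = (\<Sum>i\<in>UNIV. (S $ i \<bullet> z)\<^sup>2)"
    by (simp add: norm_vec_def L2_set_def sum_nonneg matrix_vector_mult_def inner_vec_def)
  also have "\<dots> \<le> (\<Sum>i\<in>UNIV. (norm (S $ i) * norm z)\<^sup>2)"
    by (intro sum_mono power2_le_iff_abs_le[THEN iffD2] Cauchy_Schwarz_ineq2) auto
  also have "\<dots> = (norm S * norm z)\<^sup>2"
    by (simp add: norm_vec_def[of S] L2_set_def sum_nonneg power_mult_distrib sum_distrib_right)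
  finally show ?thesis by (rule power2_le_imp_le) simp
qed

text \<open>After whitening, |y| = |S z|, and |S|^2 is the trace of C, hence at most n |C|. The
  remaining |z|^2 is absorbed by half of the Gaussian exponent. What matters is a bound linear in
  the norm of \<open>C\<close> with a constant independent of \<open>C\<close>.\<close>

lemma gauss_dens_second_moment:
  obtains m where "0 \<le> m"
    "\<And>C :: real^'n^'n. transpose C = C \<Longrightarrow> pos_def_mat C \<Longrightarrow>
      (\<integral>\<^sup>+y. ennreal (gauss_dens C y * (norm y)\<^sup>2) \<partial>lborel) \<le> ennreal (m * norm C)"
proof -
  define k where "k = (4 * pi) powr (- real CARD('n) / 2)"
  define l where "l = (8 * pi) powr (- real CARD('n) / 2)"
  have l0: "l > 0" and k0: "k > 0" by (simp_all add: l_def k_def)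
  \<comment> \<open>The 8 comes from |z|^2 \<le> 8 exp(|z|^2/8), \<open>k / l\<close> from the
    change of normalisation between the two Gaussians, and the dimension from the trace.\<close>
  define m where "m = 8 * (k / l) * real CARD('n)"
  have m0: "0 \<le> m" using k0 l0 by (simp add: m_def)
  show ?thesis
  proof (rule that[OF m0])
    fix C :: "real^'n^'n" assume C: "transpose C = C" "pos_def_mat C"
    obtain V S :: "real^'n^'n" where V: "S ** V = mat 1" "C = S ** transpose S" "matrix_inv C = transpose V ** V"
      "det V \<noteq> 0" "det C powr (- (1/2)) = \<bar>det V\<bar>"
      using pos_def_factor'[OF C] by metis
    have "(norm S)\<^sup>2 = (\<Sum>i\<in>UNIV. C $ i $ i)"
      by (simp add: V(2) norm_vec_def[of S] norm_vec_def L2_set_def sum_nonneg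
          matrix_matrix_mult_def transpose_def power2_eq_square)
    also have "\<dots> \<le> (\<Sum>i\<in>(UNIV :: 'n set). norm C)"
    proof (rule sum_mono)
      fix i
      show "C $ i $ i \<le> norm C"
        using component_le_norm_cart[of "C $ i" i] Finite_Cartesian_Product.norm_nth_le[of C i] by linarith
    qed
    finally have S2: "(norm S)\<^sup>2 \<le> real CARD('n) * norm C" by simp
    define F where "F z = ennreal (k * exp (- (norm z)\<^sup>2 / 4) * (norm (S *v z))\<^sup>2)" for z
    have [measurable]: "F \<in> borel_measurable borel"
      unfolding F_def by measurable
    have "(\<integral>\<^sup>+y. ennreal (gauss_dens C y * (norm y)\<^sup>2) \<partial>lborel)
        = (\<integral>\<^sup>+y. ennreal \<bar>det V\<bar> * F (V *v y) \<partial>lborel)"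
      by (simp add: F_def gauss_dens_def V(3,5) inner_transpose_mult_self matrix_vector_mul_assoc V(1)
          k_def mult_ac flip: ennreal_mult')
    also have "\<dots> = (\<integral>\<^sup>+z. F z \<partial>lborel)"
      by (rule nn_integral_linear_image[OF V(4)]) measurable
    also have "\<dots> \<le> (\<integral>\<^sup>+z. ennreal (m * norm C) * ennreal (l * exp (- (norm z)\<^sup>2 / 8)) \<partial>(lborel :: (real^'n) measure))"
    proof (rule nn_integral_mono)
      fix z :: "real^'n"
      have "(norm (S *v z))\<^sup>2 \<le> (norm S)\<^sup>2 * (norm z)\<^sup>2"
        using norm_matrix_vector_mult_Frobenius[of S z] power_mono[of _ _ 2]
        by (fastforce simp: power_mult_distrib[symmetric])
      moreover have "(norm z)\<^sup>2 \<le> 8 * exp ((norm z)\<^sup>2 / 8)"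
        using exp_ge_add_one_self[of "(norm z)\<^sup>2 / 8"] by linarith
      then have "(norm S)\<^sup>2 * (norm z)\<^sup>2 \<le> (real CARD('n) * norm C) * (8 * exp ((norm z)\<^sup>2 / 8))"
        by (intro mult_mono S2) auto
      ultimately have "(norm (S *v z))\<^sup>2 \<le> (real CARD('n) * norm C) * (8 * exp ((norm z)\<^sup>2 / 8))"
        by linarith
      then have "k * exp (- (norm z)\<^sup>2 / 4) * (norm (S *v z))\<^sup>2
         \<le> k * exp (- (norm z)\<^sup>2 / 4) * ((real CARD('n) * norm C) * (8 * exp ((norm z)\<^sup>2 / 8)))"
        using k0 by (intro mult_left_mono) auto
      also have "\<dots> = (m * norm C) * (l * (exp (- (norm z)\<^sup>2 / 4) * exp ((norm z)\<^sup>2 / 8)))"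
        using l0 by (simp add: m_def)
      also have "exp (- (norm z)\<^sup>2 / 4) * exp ((norm z)\<^sup>2 / 8) = exp (- (norm z)\<^sup>2 / 8)"
        by (simp flip: exp_add)
      finally show "F z \<le> ennreal (m * norm C) * ennreal (l * exp (- (norm z)\<^sup>2 / 8))"
        using m0 l0 by (simp add: F_def ennreal_leI flip: ennreal_mult)
    qed
    also have "\<dots> = ennreal (m * norm C) * (\<integral>\<^sup>+z. ennreal (l * exp (- (norm z)\<^sup>2 / 8)) \<partial>(lborel :: (real^'n) measure))"
      by (rule nn_integral_cmult) measurable
    also have "\<dots> = ennreal (m * norm C)"
      using nn_integral_gaussian_product[of 2, where 'n = 'n] by (simp add: l_def)
    finally show "(\<integral>\<^sup>+y. ennreal (gauss_dens C y * (norm y)\<^sup>2) \<partial>lborel) \<le> ennreal (m * norm C)" .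
  qed
qed

section \<open>Marchaud derivatives\<close>

text \<open>Power and Beta integrals are available as gauge integrals; nonnegativity turns them into
  Lebesgue integrals with the same value.\<close>

lemma has_bochner_integral_nonneg_has_integral:
  fixes f :: "real \<Rightarrow> real"
  assumes "f \<in> borel_measurable borel" "\<And>x. x \<in> S \<Longrightarrow> 0 \<le> f x" "(f has_integral I) S" "S \<in> sets borel"
  shows "has_bochner_integral lborel (\<lambda>x. indicator S x * f x) I"
proof -
  have hi: "((\<lambda>x. indicator S x * f x) has_integral I) UNIV"
  proof -
    have "(\<lambda>x. indicator S x * f x) = (\<lambda>x. if x \<in> S then f x else 0)"
      by (auto simp: fun_eq_iff)
    then show ?thesis using assms(3) by (simp add: has_integral_restrict_UNIV)
  qed
  have I: "0 \<le> I"
    using has_integral_nonneg[OF assms(3)] assms(2) by blast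
  have [measurable]: "(\<lambda>x. indicator S x * f x) \<in> borel_measurable borel"
    using assms by measurable
  have nn: "0 \<le> indicator S x * f x" for x
    using assms(2) by (simp add: indicator_def)
  show ?thesis
    by (rule has_bochner_integral_nn_integral)
      (use I nn nn_integral_has_integral_lborel[OF _ nn hi] in auto)
qed

lemma integrable_powr_near_0:
  fixes a c :: real
  assumes "-1 < a" "0 \<le> c"
  shows "has_bochner_integral lborel (\<lambda>x. indicator {0..c} x * x powr a) (c powr (a + 1) / (a + 1))"
  by (rule has_bochner_integral_nonneg_has_integral) (use assms has_integral_powr_from_0 in auto)

lemma integrable_powr_at_infinity:
  fixes a c :: real
  assumes "a < -1" "0 < c"
  shows "integrable lborel (\<lambda>x. indicator {c..} x * x powr a)"
  using has_bochner_integral_nonneg_has_integral[OF _ _ has_integral_powr_to_inf[OF assms]]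
  by (auto simp: has_bochner_integral_iff)

text \<open>The forward Marchaud derivative up to its normalising factor -s / Gamma(1 - s). Forward
  increments match the semigroup, which moves only to later times.\<close>

definition marchaud :: "real \<Rightarrow> (real \<Rightarrow> real) \<Rightarrow> real \<Rightarrow> real" where
  "marchaud s v r = (\<integral>h. indicator {0<..} h * (h powr (-1 - s) * (v (r + h) - v r)) \<partial>lborel)"

text \<open>A majorant with two regimes: the Lipschitz bound \<open>L * h\<close> handles h near 0
  because s < 1, and the constant \<open>M\<close> handles large h because s > 0.\<close>

definition marchaud_dom :: "real \<Rightarrow> real \<Rightarrow> real \<Rightarrow> real \<Rightarrow> real" where
  "marchaud_dom s L M h = indicator {0<..} h * (h powr (-1 - s) * min (L * h) M)"

lemma marchaud_dom_integrable:
  assumes s: "0 < s" "s < 1" and "0 \<le> L" "0 \<le> M"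
  shows "integrable lborel (marchaud_dom s L M)"
proof (rule Bochner_Integration.integrable_bound)
  show "integrable lborel (\<lambda>h. L * (indicator {0..1} h * h powr (-s)) + M * (indicator {1..} h * h powr (-1 - s)))"
    using integrable_powr_near_0[of "-s" 1] integrable_powr_at_infinity[of "-1 - s" 1] s
    by (auto simp: has_bochner_integral_iff)
  show "marchaud_dom s L M \<in> borel_measurable lborel"
    unfolding marchaud_dom_def by measurable
  show "AE h in lborel. norm (marchaud_dom s L M h)
      \<le> norm (L * (indicator {0..1} h * h powr (-s)) + M * (indicator {1..} h * h powr (-1 - s)))"
  proof (intro AE_I2)
    fix h :: real
    consider "h \<le> 0" | "0 < h" "h \<le> 1" | "1 < h" by linarith
    then show "norm (marchaud_dom s L M h)
      \<le> norm (L * (indicator {0..1} h * h powr (-s)) + M * (indicator {1..} h * h powr (-1 - s)))"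
    proof cases
      case 1 then show ?thesis using assms by (auto simp: marchaud_dom_def indicator_def)
    next
      case 2
      have "h powr (-1 - s) * min (L * h) M \<le> h powr (-1 - s) * (L * h)"
        by (intro mult_left_mono) auto
      also have "\<dots> = L * h powr (-s)"
        using 2 powr_add[of h "-1 - s" 1] by simp
      finally show ?thesis
        using 2 assms by (auto simp: marchaud_dom_def indicator_def)
    next
      case 3
      have "h powr (-1 - s) * min (L * h) M \<le> h powr (-1 - s) * M"
        by (intro mult_left_mono) auto
      then show ?thesis
        using 3 assms by (auto simp: marchaud_dom_def mult.commute)
    qed
  qed
qed

lemma marchaud_integrand_bound:
  assumes "\<And>x y. \<bar>v x - v y\<bar> \<le> L * \<bar>x - y\<bar>" "\<And>x. \<bar>v x\<bar> \<le> M"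
  shows "norm (indicator {0<..} h * (h powr (-1 - s) * (v (r + h) - v r))) \<le> marchaud_dom s L (2 * M) h"
proof (cases "0 < h")
  case True
  have "\<bar>v (r + h) - v r\<bar> \<le> min (L * h) (2 * M)"
    using assms(1)[of "r + h" r] assms(2)[of "r + h"] assms(2)[of r] True by auto
  then show ?thesis
    using True by (auto simp: marchaud_dom_def abs_mult intro!: mult_left_mono)
qed (simp add: marchaud_dom_def)

lemma lipschitz_imp_continuous_on_UNIV:
  fixes v :: "real \<Rightarrow> real"
  assumes "\<And>x y. \<bar>v x - v y\<bar> \<le> L * \<bar>x - y\<bar>"
  shows "continuous_on UNIV v"
proof -
  have "\<bar>v x - v y\<bar> \<le> \<bar>L\<bar> * \<bar>x - y\<bar>" for x y
    using assms[of x y] by (meson abs_ge_self abs_ge_zero mult_right_mono order_trans)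
  then have "\<bar>L\<bar>-lipschitz_on UNIV v" by (intro lipschitz_onI) (auto simp: dist_real_def)
  then show ?thesis by (rule lipschitz_on_continuous_on)
qed

text \<open>Ensures that \<open>marchaud\<close> is a genuine integral and not the default value 0
  of the Bochner integral.\<close>

lemma marchaud_integrable:
  fixes s :: real
  assumes s: "0 < s" "s < 1" and L: "0 \<le> L" "0 \<le> M"
    and v: "\<And>x y. \<bar>v x - v y\<bar> \<le> L * \<bar>x - y\<bar>" "\<And>x. \<bar>v x\<bar> \<le> M"
  shows "integrable lborel (\<lambda>h. indicator {0<..} h * (h powr (-1 - s) * (v (r + h) - v r)) :: real)"
proof (rule Bochner_Integration.integrable_bound)
  show "integrable lborel (marchaud_dom s L (2 * M))"
    using marchaud_dom_integrable[OF s] L by simp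
  have [measurable]: "v \<in> borel_measurable borel"
    by (intro borel_measurable_continuous_onI lipschitz_imp_continuous_on_UNIV[OF v(1)])
  show "(\<lambda>h. indicator {0<..} h * (h powr (-1 - s) * (v (r + h) - v r))) \<in> borel_measurable lborel"
    by measurable
  show "AE h in lborel. norm (indicator {0<..} h * (h powr (-1 - s) * (v (r + h) - v r)))
      \<le> norm (marchaud_dom s L (2 * M) h)"
    using order_trans[OF marchaud_integrand_bound[OF v]] by (intro AE_I2) auto
qed

lemma marchaud_bound:
  fixes s :: real
  assumes s: "0 < s" "s < 1" and L: "0 \<le> L" "0 \<le> M"
    and v: "\<And>x y. \<bar>v x - v y\<bar> \<le> L * \<bar>x - y\<bar>" "\<And>x. \<bar>v x\<bar> \<le> M"
  shows "\<bar>marchaud s v r\<bar> \<le> (\<integral>h. marchaud_dom s L (2 * M) h \<partial>lborel)"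
proof -
  have "norm (marchaud s v r) \<le> (\<integral>h. marchaud_dom s L (2 * M) h \<partial>lborel)"
    unfolding marchaud_def
    by (rule Bochner_Integration.integral_norm_bound_integral[OF marchaud_integrable[OF assms] marchaud_dom_integrable])
      (use assms marchaud_integrand_bound[OF v] in auto)
  then show ?thesis by simp
qed

text \<open>Scaling r = \<rho> x produces the powers \<rho>, \<rho>^(s-1) and \<rho>^(-s), whose
  product is 1. The independence of \<rho> is what makes Abel inversion work.\<close>

lemma nn_integral_beta_convolution:
  assumes s: "0 < s" "s < 1" and \<rho>: "0 < \<rho>"
  shows "(\<integral>\<^sup>+r. ennreal (indicator {0<..<\<rho>} r * (r powr (s - 1) * (\<rho> - r) powr (-s))) \<partial>lborel)
    = ennreal (Gamma s * Gamma (1 - s))"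
proof -
  have B: "has_bochner_integral lborel (\<lambda>x. indicator {0..1} x * (x powr (s - 1) * (1 - x) powr ((1 - s) - 1))) (Beta s (1 - s))"
    by (rule has_bochner_integral_nonneg_has_integral) (use s has_integral_Beta_real[of s "1 - s"] in auto)
  have Bv: "Beta s (1 - s) = Gamma s * Gamma (1 - s)" by (simp add: Beta_def)
  have "(\<integral>\<^sup>+r. ennreal (indicator {0<..<\<rho>} r * (r powr (s - 1) * (\<rho> - r) powr (-s))) \<partial>lborel)
     = \<bar>\<rho>\<bar> * (\<integral>\<^sup>+x. ennreal (indicator {0<..<\<rho>} (0 + \<rho> * x) * ((0 + \<rho> * x) powr (s - 1) * (\<rho> - (0 + \<rho> * x)) powr (-s))) \<partial>lborel)"
    by (rule nn_integral_real_affine) (use \<rho> in auto)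
  also have "\<dots> = (\<integral>\<^sup>+x. ennreal \<bar>\<rho>\<bar> * ennreal (indicator {0<..<\<rho>} (0 + \<rho> * x) * ((0 + \<rho> * x) powr (s - 1) * (\<rho> - (0 + \<rho> * x)) powr (-s))) \<partial>lborel)"
    by (rule nn_integral_cmult[symmetric]) measurable
  also have "\<dots> = (\<integral>\<^sup>+x. ennreal (indicator {0..1} x * (x powr (s - 1) * (1 - x) powr ((1 - s) - 1))) \<partial>lborel)"
  proof (intro nn_integral_cong_AE)
    have "AE x in lborel. x \<noteq> (0::real) \<and> x \<noteq> 1"
      by (intro AE_conjI AE_lborel_singleton)
    then show "AE x in lborel. ennreal \<bar>\<rho>\<bar> * ennreal (indicator {0<..<\<rho>} (0 + \<rho> * x) * ((0 + \<rho> * x) powr (s - 1) * (\<rho> - (0 + \<rho> * x)) powr (-s)))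
       = ennreal (indicator {0..1} x * (x powr (s - 1) * (1 - x) powr ((1 - s) - 1)))"
    proof eventually_elim
      case (elim x)
      show ?case
      proof (cases "0 < x \<and> x < 1")
        case True
        have "\<rho> * ((\<rho> * x) powr (s - 1) * (\<rho> - \<rho> * x) powr (-s))
            = \<rho> * ((\<rho> * x) powr (s - 1) * (\<rho> * (1 - x)) powr (-s))" by (simp add: algebra_simps)
        also have "\<dots> = \<rho> * (\<rho> powr (s - 1) * \<rho> powr (-s)) * (x powr (s - 1) * (1 - x) powr (-s))"
          using True \<rho> by (simp add: powr_mult)
        also have "\<rho> powr (s - 1) * \<rho> powr (-s) = inverse \<rho>"
          using \<rho> by (simp only: powr_add[symmetric]) (simp add: powr_minus)
        finally show ?thesis
          using True \<rho> by (simp add: indicator_def flip: ennreal_mult)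
      next
        case False
        then have "\<not> (0 < \<rho> * x \<and> \<rho> * x < \<rho>)" using \<rho>
          by (auto simp: zero_less_mult_iff)
        then show ?thesis using False elim by (auto simp: indicator_def)
      qed
    qed
  qed
  also have "\<dots> = ennreal (Beta s (1 - s))"
    using B by (subst nn_integral_eq_integral) (auto simp: has_bochner_integral_iff indicator_def)
  finally show ?thesis by (simp add: Bv)
qed

text \<open>Integration by parts in h. The boundary term is O(h^(1-s)) at 0 by the Lipschitz bound
  and O(h^(-s)) at infinity by boundedness, so it disappears at both ends.\<close>

lemma marchaud_eq_integral_deriv:
  fixes v v' :: "real \<Rightarrow> real"
  assumes s: "0 < s" "s < 1"
    and d: "\<And>x. (v has_real_derivative v' x) (at x)" and c: "continuous_on UNIV v'"
    and L: "\<And>x. \<bar>v' x\<bar> \<le> L" and M: "\<And>x. \<bar>v x\<bar> \<le> M" and R: "\<And>x. R < x \<Longrightarrow> v' x = 0"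
  shows "marchaud s v r = (1 / s) * (\<integral>h. indicator {0<..} h * (h powr (-s) * v' (r + h)) \<partial>lborel)"
proof -
  have L0: "0 \<le> L" and M0: "0 \<le> M" using L[of 0] M[of 0] by auto
  have lip: "\<bar>v x - v y\<bar> \<le> L * \<bar>x - y\<bar>" for x y
    using field_differentiable_bound[of UNIV v v' L x y] d L by auto
  have [measurable]: "v' \<in> borel_measurable borel"
    by (intro borel_measurable_continuous_onI c)
  have int1: "integrable lborel (\<lambda>h. indicator {0<..} h * (h powr (-1 - s) * (v (r + h) - v r)))"
    by (rule marchaud_integrable[OF s L0 M0 lip M])
  have int2: "integrable lborel (\<lambda>h. indicator {0<..} h * (h powr (-s) * v' (r + h)))"
  proof (rule Bochner_Integration.integrable_bound)
    \<comment> \<open>Only h up to \<open>R - r\<close> contribute, since \<open>v'\<close> vanishes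
      beyond \<open>R\<close>; the \<open>max\<close> covers the case where \<open>r\<close> already
      lies beyond \<open>R\<close>.\<close>
    show "integrable lborel (\<lambda>h. L * (indicator {0..max 0 (R - r)} h * h powr (-s)))"
      using integrable_powr_near_0[of "-s" "max 0 (R - r)"] s by (auto simp: has_bochner_integral_iff)
    show "AE h in lborel. norm (indicator {0<..} h * (h powr (-s) * v' (r + h)))
        \<le> norm (L * (indicator {0..max 0 (R - r)} h * h powr (-s)))"
    proof (intro AE_I2)
      fix h :: real
      consider "h \<le> 0" | "0 < h" "r + h > R" | "0 < h" "r + h \<le> R" by linarith
      then show "norm (indicator {0<..} h * (h powr (-s) * v' (r + h)))
        \<le> norm (L * (indicator {0..max 0 (R - r)} h * h powr (-s)))"
      proof cases
        case 3
        then show ?thesis using L[of "r + h"] L0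
          by (auto simp: abs_mult mult.commute[of L] intro!: mult_left_mono)
      qed (use R in auto)
    qed
  qed measurable
  \<comment> \<open>The derivative of \<open>F\<close> is \<open>f\<close>, the difference of the
    two integrands, so the claim becomes that \<open>f\<close> has integral 0 over the half
    line.\<close>
  define F where "F h = - (h powr (-s) / s * (v (r + h) - v r))" for h
  define f where "f h = h powr (-1 - s) * (v (r + h) - v r) - h powr (-s) / s * v' (r + h)" for h
  have "(LBINT x=ereal 0..\<infinity>. f x) = 0 - 0"
  proof (rule interval_integral_FTC_integrable)
    show "ereal 0 < \<infinity>" by simp
    fix x :: real assume x: "ereal 0 < ereal x" "ereal x < \<infinity>"
    then have x: "0 < x" by simp
    have dv: "((\<lambda>h. v (r + h)) has_real_derivative v' (r + x)) (at x)"
      using DERIV_shift[of v "v' (r + x)" x r] d by (simp add: add.commute)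
    have e: "- s - 1 = -1 - s" by simp
    have "((\<lambda>h. h powr (-s)) has_real_derivative (-s) * x powr (-1 - s)) (at x)"
      using x unfolding e[symmetric] by (auto intro!: derivative_eq_intros)
    then have "(F has_real_derivative
        - ((-s) * x powr (-1 - s) / s * (v (r + x) - v r) + (v' (r + x) - 0) * (x powr (-s) / s))) (at x)"
      unfolding F_def by (intro DERIV_minus DERIV_mult DERIV_cdivide DERIV_diff dv DERIV_const)
    moreover have "- ((-s) * x powr (-1 - s) / s * (v (r + x) - v r) + (v' (r + x) - 0) * (x powr (-s) / s)) = f x"
      using s by (simp add: f_def mult.commute)
    ultimately have "(F has_real_derivative f x) (at x)" by simp
    then show "(F has_vector_derivative f x) (at x)"
      by (simp add: has_real_derivative_iff_has_vector_derivative)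
    have "continuous_on UNIV (\<lambda>h. v' (r + h))"
      by (intro continuous_on_compose2[OF c] continuous_intros) auto
    then have "isCont (\<lambda>h. v' (r + h)) x" by (simp add: continuous_on_eq_continuous_at)
    moreover have "isCont (\<lambda>h. v (r + h)) x" using dv DERIV_isCont by blast
    ultimately show "isCont f x"
      unfolding f_def using x s by (intro continuous_intros) auto
  next
    have "integrable lborel (\<lambda>h. indicator {0<..} h * (h powr (-1 - s) * (v (r + h) - v r))
        - (1 / s) * (indicator {0<..} h * (h powr (-s) * v' (r + h))))"
      using int1 int2 by auto
    then show "set_integrable lborel (einterval (ereal 0) \<infinity>) f"
      unfolding set_integrable_def f_def
      by (rule Bochner_Integration.integrable_cong[THEN iffD1, rotated 2])
        (auto simp: einterval_def indicator_def field_simps)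
  next
    have "(F \<longlongrightarrow> 0) (at_right 0)"
    proof (rule Lim_null_comparison)
      show "\<forall>\<^sub>F h in at_right 0. norm (F h) \<le> L / s * h powr (1 - s)"
      proof (rule eventually_at_rightI[of 0 1])
        fix h :: real assume h: "h \<in> {0<..<1}"
        have "norm (F h) = h powr (-s) / s * \<bar>v (r + h) - v r\<bar>"
          using s by (simp add: F_def abs_mult)
        also have "\<dots> \<le> h powr (-s) / s * (L * h)"
          using lip[of "r + h" r] s h by (intro mult_left_mono) auto
        also have "\<dots> = L / s * h powr (1 - s)"
          using h powr_add[of h "-s" 1] by (simp add: field_simps)
        finally show "norm (F h) \<le> L / s * h powr (1 - s)" .
      qed simp
      show "((\<lambda>h. L / s * h powr (1 - s)) \<longlongrightarrow> 0) (at_right 0)"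
        using s by real_asymp
    qed
    then show "((F \<circ> real_of_ereal) \<longlongrightarrow> 0) (at_right (ereal 0))"
      by (simp add: ereal_tendsto_simps)
    have "(F \<longlongrightarrow> 0) at_top"
    proof (rule Lim_null_comparison)
      show "\<forall>\<^sub>F h in at_top. norm (F h) \<le> 2 * M / s * h powr (-s)"
        using eventually_gt_at_top[of 0]
      proof eventually_elim
        fix h :: real assume h: "0 < h"
        have "norm (F h) = h powr (-s) / s * \<bar>v (r + h) - v r\<bar>"
          using s by (simp add: F_def abs_mult)
        also have "\<dots> \<le> h powr (-s) / s * (2 * M)"
          using M[of "r + h"] M[of r] s h by (intro mult_left_mono) auto
        finally show "norm (F h) \<le> 2 * M / s * h powr (-s)" by (simp add: field_simps)
      qed
      show "((\<lambda>h. 2 * M / s * h powr (-s)) \<longlongrightarrow> 0) at_top"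
        using s by real_asymp
    qed
    then show "((F \<circ> real_of_ereal) \<longlongrightarrow> 0) (at_left \<infinity>)"
      by (simp add: ereal_tendsto_simps)
  qed
  then have "0 = (\<integral>h. indicator {0<..} h * f h \<partial>lborel)"
    by (simp add: interval_lebesgue_integral_def set_lebesgue_integral_def einterval_def greaterThan_def)
  also have "\<dots> = (\<integral>h. indicator {0<..} h * (h powr (-1 - s) * (v (r + h) - v r))
        - (1 / s) * (indicator {0<..} h * (h powr (-s) * v' (r + h))) \<partial>lborel)"
    by (intro Bochner_Integration.integral_cong) (auto simp: f_def field_simps indicator_def)
  also have "\<dots> = marchaud s v r - (1 / s) * (\<integral>h. indicator {0<..} h * (h powr (-s) * v' (r + h)) \<partial>lborel)"
    unfolding marchaud_def using int1 int2 by simp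
  finally show ?thesis by simp
qed

text \<open>Insert the formula with \<open>v'\<close>, substitute \<rho> = r + h, and exchange the
  integrals: integrating over r in (a, \<rho>) gives the constant Gamma(s) Gamma(1 - s), and then
  the integral of \<open>v'\<close> over (a, \<infinity>) is -v(a). The 1/s in the value comes from
  the integration by parts.\<close>

lemma marchaud_fractional_integral_C1:
  fixes v v' :: "real \<Rightarrow> real"
  assumes s: "0 < s" "s < 1"
    and d: "\<And>x. (v has_real_derivative v' x) (at x)" and c: "continuous_on UNIV v'"
    and L: "\<And>x. \<bar>v' x\<bar> \<le> L" and M: "\<And>x. \<bar>v x\<bar> \<le> M"
    and R: "\<And>x. R \<le> x \<Longrightarrow> v x = 0" "\<And>x. R < x \<Longrightarrow> v' x = 0"
  shows "has_bochner_integral lborel (\<lambda>r. indicator {a<..} r * ((r - a) powr (s - 1) * marchaud s v r))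
    (- (Gamma s * Gamma (1 - s) / s) * v a)"
proof -
  define \<beta> where "\<beta> = Gamma s * Gamma (1 - s)"
  have \<beta>: "\<beta> > 0" using s by (simp add: \<beta>_def Gamma_real_pos)
  have L0: "0 \<le> L" using L[of 0] by auto
  have [measurable]: "v' \<in> borel_measurable borel"
    by (intro borel_measurable_continuous_onI c)
  define w where "w r \<rho> = (if a < r \<and> r < \<rho> then (r - a) powr (s - 1) * (\<rho> - r) powr (-s) else 0)" for r \<rho> :: real
  have [measurable]: "(\<lambda>p. w (fst p) (snd p)) \<in> borel_measurable (borel \<Otimes>\<^sub>M borel)"
    unfolding w_def by measurable
  have w0: "0 \<le> w r \<rho>" for r \<rho> by (simp add: w_def)
  have wint: "(\<integral>\<^sup>+r. ennreal (w r \<rho>) \<partial>lborel) = ennreal (indicator {a<..} \<rho> * \<beta>)" for \<rho>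
  proof (cases "a < \<rho>")
    case True
    have "(\<integral>\<^sup>+r. ennreal (w r \<rho>) \<partial>lborel) = ennreal \<bar>1\<bar> * (\<integral>\<^sup>+r. ennreal (w (a + 1 * r) \<rho>) \<partial>lborel)"
      by (rule nn_integral_real_affine) (auto simp: w_def)
    also have "\<dots> = (\<integral>\<^sup>+r. ennreal (indicator {0<..<\<rho> - a} r * (r powr (s - 1) * ((\<rho> - a) - r) powr (-s))) \<partial>lborel)"
      by (simp, intro nn_integral_cong) (auto simp: w_def indicator_def diff_diff_eq)
    also have "\<dots> = ennreal \<beta>"
      unfolding \<beta>_def by (rule nn_integral_beta_convolution) (use s True in auto)
    finally show ?thesis using True by simp
  qed (auto simp: w_def intro!: nn_integral_zero')
  define G where "G r \<rho> = w r \<rho> * v' \<rho>" for r \<rho>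
  have [measurable]: "case_prod G \<in> borel_measurable (borel \<Otimes>\<^sub>M borel)"
    unfolding G_def case_prod_beta by measurable
  have intG: "integrable (lborel \<Otimes>\<^sub>M lborel) (case_prod G)"
  proof (rule integrableI_bounded)
    have "(\<integral>\<^sup>+p. ennreal (norm (case_prod G p)) \<partial>(lborel \<Otimes>\<^sub>M lborel))
        = (\<integral>\<^sup>+\<rho>. \<integral>\<^sup>+r. ennreal (norm (G r \<rho>)) \<partial>lborel \<partial>lborel)"
      by (subst lborel_pair.nn_integral_snd[symmetric]) auto
    \<comment> \<open>The inner integral is at most \<open>\<beta>\<close> times |v'|, which is
      bounded and vanishes beyond \<open>R\<close>; this justifies Fubini.\<close>
    also have "\<dots> \<le> (\<integral>\<^sup>+\<rho>. ennreal (\<beta> * L) * indicator {a..max a R} \<rho> \<partial>lborel)"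
    proof (rule nn_integral_mono)
      fix \<rho> :: real
      have [measurable]: "(\<lambda>r. w r \<rho>) \<in> borel_measurable borel" unfolding w_def by measurable
      have "(\<integral>\<^sup>+r. ennreal (norm (G r \<rho>)) \<partial>lborel) = (\<integral>\<^sup>+r. ennreal (w r \<rho>) * ennreal \<bar>v' \<rho>\<bar> \<partial>lborel)"
        by (simp add: G_def abs_mult w0 ennreal_mult)
      also have "\<dots> = ennreal (indicator {a<..} \<rho> * \<beta>) * ennreal \<bar>v' \<rho>\<bar>"
        by (subst nn_integral_multc) (auto simp: wint)
      also have "\<dots> \<le> ennreal (\<beta> * L) * indicator {a..max a R} \<rho>"
        using L[of \<rho>] R(2)[of \<rho>] \<beta>
        by (auto simp: indicator_def ennreal_mult[symmetric] intro!: ennreal_leI mult_left_mono)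
      finally show "(\<integral>\<^sup>+r. ennreal (norm (G r \<rho>)) \<partial>lborel) \<le> ennreal (\<beta> * L) * indicator {a..max a R} \<rho>" .
    qed
    also have "\<dots> < \<infinity>"
      by (simp add: nn_integral_cmult ennreal_mult_less_top)
    finally show "(\<integral>\<^sup>+p. ennreal (norm (case_prod G p)) \<partial>(lborel \<Otimes>\<^sub>M lborel)) < \<infinity>" .
  qed measurable
  have inner: "(\<integral>\<rho>. G r \<rho> \<partial>lborel) = s * (indicator {a<..} r * ((r - a) powr (s - 1) * marchaud s v r))" for r
  proof (cases "a < r")
    case True
    have "(\<integral>\<rho>. G r \<rho> \<partial>lborel) = \<bar>1\<bar> *\<^sub>R (\<integral>h. G r (r + 1 * h) \<partial>lborel)"
      by (rule lborel_integral_real_affine) simp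
    also have "\<dots> = (\<integral>h. (r - a) powr (s - 1) * (indicator {0<..} h * (h powr (-s) * v' (r + h))) \<partial>lborel)"
      unfolding abs_one scaleR_one
      by (intro Bochner_Integration.integral_cong) (use True in \<open>auto simp: G_def w_def indicator_def\<close>)
    also have "\<dots> = (r - a) powr (s - 1) * (s * marchaud s v r)"
      using marchaud_eq_integral_deriv[OF s d c L M, of R r] R(2) s by simp
    finally show ?thesis using True by simp
  qed (simp add: G_def w_def)
  have outer: "(\<integral>r. G r \<rho> \<partial>lborel) = \<beta> * (indicator {a<..} \<rho> * v' \<rho>)" for \<rho>
  proof -
    have "has_bochner_integral lborel (\<lambda>r. w r \<rho>) (indicator {a<..} \<rho> * \<beta>)"
      by (rule has_bochner_integral_nn_integral)
        (use w0 \<beta> wint in \<open>auto simp: w_def\<close>)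
    then show ?thesis by (simp add: G_def has_bochner_integral_iff)
  qed
  have "(\<integral>\<rho>. indicator {a<..} \<rho> * v' \<rho> \<partial>lborel) = (\<integral>\<rho>. indicator {a..max a R} \<rho> *\<^sub>R v' \<rho> \<partial>lborel)"
  proof (rule integral_cong_AE)
    show "AE \<rho> in lborel. indicator {a<..} \<rho> * v' \<rho> = indicator {a..max a R} \<rho> *\<^sub>R v' \<rho>"
      using AE_lborel_singleton[of a] by eventually_elim (use R(2) in \<open>auto simp: indicator_def\<close>)
  qed measurable
  also have "\<dots> = v (max a R) - v a"
    by (rule integral_FTC_Icc)
      (use d c in \<open>auto simp: has_real_derivative_iff_has_vector_derivative[symmetric]
        intro: has_field_derivative_at_within continuous_on_subset\<close>)
  finally have ftc: "(\<integral>\<rho>. indicator {a<..} \<rho> * v' \<rho> \<partial>lborel) = - v a" using R(1) by simp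
  have "(\<integral>r. (\<integral>\<rho>. G r \<rho> \<partial>lborel) \<partial>lborel) = (\<integral>\<rho>. (\<integral>r. G r \<rho> \<partial>lborel) \<partial>lborel)"
    using lborel_pair.Fubini_integral[OF intG] by simp
  then have "s * (\<integral>r. indicator {a<..} r * ((r - a) powr (s - 1) * marchaud s v r) \<partial>lborel) = \<beta> * (- v a)"
    unfolding inner outer by (simp add: ftc)
  then have val: "(\<integral>r. indicator {a<..} r * ((r - a) powr (s - 1) * marchaud s v r) \<partial>lborel)
      = - (Gamma s * Gamma (1 - s) / s) * v a"
    using s by (simp add: \<beta>_def field_simps)
  have "integrable lborel (\<lambda>r. s * (indicator {a<..} r * ((r - a) powr (s - 1) * marchaud s v r)))"
    using lborel_pair.integrable_fst'[OF intG] by (simp add: inner)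
  then have "integrable lborel (\<lambda>r. indicator {a<..} r * ((r - a) powr (s - 1) * marchaud s v r))"
    using s by simp
  with val show ?thesis by (simp add: has_bochner_integral_iff)
qed

text \<open>Cut off on the right, then average over a short interval ahead of the point. Forward
  averaging preserves vanishing beyond n. Nothing is cut on the left, because the Marchaud
  derivative never looks back. The extra \<open>M\<close> in the bound \<open>L + M\<close> is the
  product rule for the cutoff, which has Lipschitz constant 1.\<close>

lemma smooth_compact_approximation:
  fixes u :: "real \<Rightarrow> real"
  assumes u: "\<And>x y. \<bar>u x - u y\<bar> \<le> L * \<bar>x - y\<bar>" "\<And>x. \<bar>u x\<bar> \<le> M"
  obtains v v' where
    "\<And>n x. (v n has_real_derivative v' n x) (at x)" "\<And>n. continuous_on UNIV (v' n)"
    "\<And>n x. \<bar>v' n x\<bar> \<le> L + M" "\<And>n x. \<bar>v n x\<bar> \<le> M"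
    "\<And>n x. real n \<le> x \<Longrightarrow> v n x = 0" "\<And>n x. real n < x \<Longrightarrow> v' n x = 0"
    "\<And>x. (\<lambda>n. v n x) \<longlonglongrightarrow> u x"
proof -
  have M0: "0 \<le> M" using u(2)[of 0] by auto
  \<comment> \<open>The cutoff is 1 up to n - 1, 0 from n on, and linear in between.\<close>
  define \<eta> where "\<eta> n x = max 0 (min 1 (real n - x))" for n :: nat and x :: real
  define w where "w n x = \<eta> n x * u x" for n x
  define \<delta> where "\<delta> n = 1 / real (Suc n)" for n
  have \<delta>: "0 < \<delta> n" for n by (simp add: \<delta>_def)
  have \<eta>: "0 \<le> \<eta> n x" "\<eta> n x \<le> 1" "\<bar>\<eta> n x - \<eta> n y\<bar> \<le> \<bar>x - y\<bar>" for n x y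
    by (auto simp: \<eta>_def)
  have wM: "\<bar>w n x\<bar> \<le> M" for n x
    using mult_mono[OF \<eta>(2)[of n x] u(2)[of x]] \<eta>(1)[of n x] by (simp add: w_def abs_mult)
  have wL: "\<bar>w n x - w n y\<bar> \<le> (L + M) * \<bar>x - y\<bar>" for n x y
  proof -
    have "w n x - w n y = \<eta> n x * (u x - u y) + (\<eta> n x - \<eta> n y) * u y"
      by (simp add: w_def algebra_simps)
    then have "\<bar>w n x - w n y\<bar> \<le> \<eta> n x * \<bar>u x - u y\<bar> + \<bar>\<eta> n x - \<eta> n y\<bar> * \<bar>u y\<bar>"
      using \<eta>(1)[of n x] abs_triangle_ineq[of "\<eta> n x * (u x - u y)" "(\<eta> n x - \<eta> n y) * u y"]
      by (simp add: abs_mult)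
    also have "\<eta> n x * \<bar>u x - u y\<bar> \<le> 1 * (L * \<bar>x - y\<bar>)"
      using \<eta> u(1) by (intro mult_mono) auto
    also have "\<bar>\<eta> n x - \<eta> n y\<bar> * \<bar>u y\<bar> \<le> \<bar>x - y\<bar> * M"
      using \<eta> u(2) by (intro mult_mono) auto
    finally show ?thesis by (simp add: algebra_simps)
  qed
  have wc: "continuous_on A (w n)" for n A
    using lipschitz_imp_continuous_on_UNIV[OF wL] continuous_on_subset by blast
  have w0: "w n x = 0" if "real n \<le> x" for n x using that by (simp add: w_def \<eta>_def)
  define U where "U n x = (LBINT y=ereal 0..ereal x. w n y)" for n x
  have U: "(U n has_real_derivative w n x) (at x)" for n x
  proof -
    \<comment> \<open>The compact interval is chosen so that both 0 and \<open>x\<close> lie in its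
      interior.\<close>
    define b where "b = \<bar>x\<bar> + 1"
    have "((\<lambda>u. LBINT y=ereal 0..ereal u. w n y) has_vector_derivative (w n x)) (at x within {-b..b})"
      by (rule interval_integral_FTC2) (auto simp: b_def wc)
    then show ?thesis
      unfolding U_def has_real_derivative_iff_has_vector_derivative
      by (subst (asm) at_within_interior) (auto simp: b_def interior_atLeastAtMost_real)
  qed
  \<comment> \<open>\<open>v n x\<close> is the mean of \<open>w n\<close> over [x, x + \<delta>],
    so it inherits the bound on \<open>w n\<close>; its derivative is a difference quotient of
    \<open>w n\<close>, so it is bounded by the Lipschitz constant.\<close>
  define v where "v n x = (U n (x + \<delta> n) - U n x) / \<delta> n" for n x
  define v' where "v' n x = (w n (x + \<delta> n) - w n x) / \<delta> n" for n x
  have mvt: "\<exists>z. x < z \<and> z < x + \<delta> n \<and> v n x = w n z" for n x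
    using MVT2[of x "x + \<delta> n" "U n" "w n"] U \<delta>[of n] by (auto simp: v_def)
  show ?thesis
  proof (rule that)
    show "(v n has_real_derivative v' n x) (at x)" for n x
      unfolding v_def v'_def
      by (intro DERIV_cdivide DERIV_diff U DERIV_shift[THEN iffD1])
    show "continuous_on UNIV (v' n)" for n
      unfolding v'_def using \<delta>[of n]
      by (intro continuous_intros wc continuous_on_compose2[OF wc[of UNIV]]) auto
    show "\<bar>v' n x\<bar> \<le> L + M" for n x
      using wL[of n "x + \<delta> n" x] \<delta>[of n] by (simp add: v'_def field_simps)
    show "\<bar>v n x\<bar> \<le> M" for n x using mvt[of x n] wM by metis
    show "v n x = 0" if "real n \<le> x" for n x
    proof -
      obtain z where "x < z" "v n x = w n z" using mvt by blast
      then show ?thesis using w0[of n z] that by simp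
    qed
    show "v' n x = 0" if "real n < x" for n x
      using that \<delta>[of n] by (simp add: v'_def w0)
    show "(\<lambda>n. v n x) \<longlonglongrightarrow> u x" for x
    proof (rule Lim_transform_eventually)
      have "(\<lambda>n. v n x - w n x) \<longlonglongrightarrow> 0"
      proof (rule Lim_null_comparison)
        show "\<forall>\<^sub>F n in sequentially. norm (v n x - w n x) \<le> \<bar>L + M\<bar> * \<delta> n"
        proof (intro always_eventually allI)
          fix n
          obtain z where z: "x < z" "z < x + \<delta> n" "v n x = w n z" using mvt by blast
          have "\<bar>w n z - w n x\<bar> \<le> (L + M) * \<bar>z - x\<bar>" by (rule wL)
          also have "\<dots> \<le> \<bar>L + M\<bar> * \<delta> n" using z by (intro mult_mono) auto
          finally show "norm (v n x - w n x) \<le> \<bar>L + M\<bar> * \<delta> n" using z by simp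
        qed
        show "(\<lambda>n. \<bar>L + M\<bar> * \<delta> n) \<longlonglongrightarrow> 0"
          unfolding \<delta>_def by real_asymp
      qed
      then show "(\<lambda>n. (v n x - w n x) + u x) \<longlonglongrightarrow> u x"
        using tendsto_add[OF _ tendsto_const[of "u x"]] by fastforce
      show "\<forall>\<^sub>F n in sequentially. v n x - w n x + u x = v n x"
        using eventually_ge_at_top[of "nat \<lceil>x + 1\<rceil>"]
      proof eventually_elim
        case (elim n)
        then have "x + 1 \<le> real n" by linarith
        then show ?case by (simp add: w_def \<eta>_def)
      qed
    qed
  qed
qed

section \<open>Inversion of the Marchaud derivative\<close>

text \<open>The difference of two Riemann-Liouville kernels of order s with base points a and b,
  without the factor 1 / Gamma(s).\<close>

definition riesz_diff :: "real \<Rightarrow> real \<Rightarrow> real \<Rightarrow> real \<Rightarrow> real" where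
  "riesz_diff s a b r =
     indicator {a<..} r * (r - a) powr (s - 1) - indicator {b<..} r * (r - b) powr (s - 1)"

lemma riesz_diff_measurable [measurable]: "riesz_diff s a b \<in> borel_measurable borel"
  unfolding riesz_diff_def by measurable

lemma powr_diff_tendsto_0:
  fixes s a b :: real
  assumes "0 < s" "s < 1" "b < a"
  shows "((\<lambda>r. (r - a) powr s - (r - b) powr s) \<longlongrightarrow> 0) at_top"
  using assms by real_asymp

text \<open>The kernel is negative on (b, a], where only the base point \<open>b\<close>
  contributes, and nonnegative after \<open>a\<close>, because x^(s-1) decreases. Either part has
  mass (a - b)^s / s.\<close>

lemma riesz_diff_abs_integral:
  assumes s: "0 < s" "s < 1" and ba: "b < a"
  shows "has_bochner_integral lborel (\<lambda>r. \<bar>riesz_diff s a b r\<bar>) (2 * (a - b) powr s / s)"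
proof -
  \<comment> \<open>The part on [b, a], in the shape of the affine substitution rule. The end point
    r = b is harmless because \<open>0 powr (s - 1) = 0\<close>.\<close>
  define k1 where "k1 r = indicator {0..a - b} (-b + 1 * r) * (-b + 1 * r) powr (s - 1)" for r :: real
  define f where "f r = (r - a) powr (s - 1) - (r - b) powr (s - 1)" for r
  define F where "F r = ((r - a) powr s - (r - b) powr s) / s" for r
  have "has_bochner_integral lborel (\<lambda>x. indicator {0..a - b} x * x powr (s - 1)) ((a - b) powr s / s)"
    using integrable_powr_near_0[of "s - 1" "a - b"] s ba by simp
  then have 1: "has_bochner_integral lborel k1 ((a - b) powr s / s)"
    unfolding k1_def
    by (subst (asm) lborel_has_bochner_integral_real_affine_iff[of 1 _ _ "-b"]) simp_all
  have f0: "0 \<le> f r" if "a < r" for r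
    using that ba s by (simp add: f_def powr_mono2')
  have A: "((F \<circ> real_of_ereal) \<longlongrightarrow> - ((a - b) powr s / s)) (at_right (ereal a))"
  proof -
    have "((\<lambda>r. (r - a) powr s) \<longlongrightarrow> 0) (at_right a)"
      using s by real_asymp
    moreover have "((\<lambda>r. (r - b) powr s) \<longlongrightarrow> (a - b) powr s) (at_right a)"
      using ba by (intro tendsto_intros) auto
    ultimately have "(F \<longlongrightarrow> (0 - (a - b) powr s) / s) (at_right a)"
      unfolding F_def using s by (intro tendsto_divide tendsto_diff tendsto_const) auto
    then show ?thesis by (simp add: ereal_tendsto_simps)
  qed
  have B: "((F \<circ> real_of_ereal) \<longlongrightarrow> 0) (at_left \<infinity>)"
  proof -
    have "(F \<longlongrightarrow> 0 / s) at_top"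
      unfolding F_def using s ba by (intro tendsto_divide powr_diff_tendsto_0) auto
    then show ?thesis by (simp add: ereal_tendsto_simps)
  qed
  have deriv: "DERIV F r :> f r" if "ereal a < ereal r" for r
    using that ba s unfolding F_def f_def
    by (auto intro!: derivative_eq_intros simp: field_simps)
  have cont: "isCont f r" if "ereal a < ereal r" for r
    using that ba unfolding f_def by (intro continuous_intros) auto
  have "set_integrable lborel (einterval (ereal a) \<infinity>) f" "(LBINT x=ereal a..\<infinity>. f x) = 0 - (- ((a - b) powr s / s))"
    by (rule interval_integral_FTC_nonneg[OF _ deriv cont _ A B]; use f0 in auto)+
  then have 2: "has_bochner_integral lborel (\<lambda>r. indicator {a<..} r * f r) ((a - b) powr s / s)"
    by (simp add: has_bochner_integral_iff set_integrable_def interval_lebesgue_integral_def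
        set_lebesgue_integral_def einterval_def greaterThan_def)
  have "has_bochner_integral lborel (\<lambda>r. k1 r + indicator {a<..} r * f r) ((a - b) powr s / s + (a - b) powr s / s)"
    by (rule has_bochner_integral_add[OF 1 2])
  moreover have "k1 r + indicator {a<..} r * f r = \<bar>riesz_diff s a b r\<bar>" for r
  proof -
    consider "r \<le> b" | "b < r" "r \<le> a" | "a < r" by linarith
    then show ?thesis
    proof cases
      case 3
      then show ?thesis using ba f0[of r] by (auto simp: k1_def f_def riesz_diff_def indicator_def)
    qed (use ba in \<open>auto simp: k1_def f_def riesz_diff_def indicator_def\<close>)
  qed
  ultimately show ?thesis by simp
qed

lemma riesz_diff_integrable:
  assumes "0 < s" "s < 1" "b < a"
  shows "integrable lborel (riesz_diff s a b)"
  using riesz_diff_abs_integral[OF assms]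
  by (subst integrable_abs_iff[symmetric]) (simp_all add: has_bochner_integral_iff)

text \<open>Dominated convergence is used twice: inside the Marchaud derivative with
  \<open>marchaud_dom\<close>, uniformly in n, and then in r with a multiple of |riesz_diff|. The
  second step needs an integrable kernel, hence two base points.\<close>

lemma marchaud_inversion:
  fixes u :: "real \<Rightarrow> real"
  assumes s: "0 < s" "s < 1" and ba: "b < a" and L: "0 \<le> L"
    and u: "\<And>x y. \<bar>u x - u y\<bar> \<le> L * \<bar>x - y\<bar>" "\<And>x. \<bar>u x\<bar> \<le> M"
  shows "(\<integral>r. riesz_diff s a b r * marchaud s u r \<partial>lborel)
    = - (Gamma s * Gamma (1 - s) / s) * (u a - u b)"
proof -
  obtain v v' where v: "\<And>n x. (v n has_real_derivative v' n x) (at x)" "\<And>n. continuous_on UNIV (v' n)"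
    "\<And>n x. \<bar>v' n x\<bar> \<le> L + M" "\<And>n x. \<bar>v n x\<bar> \<le> M"
    "\<And>n x. real n \<le> x \<Longrightarrow> v n x = 0" "\<And>n x. real n < x \<Longrightarrow> v' n x = 0"
    "\<And>x. (\<lambda>n. v n x) \<longlonglongrightarrow> u x"
    using smooth_compact_approximation[OF u] by blast
  have M: "0 \<le> M" using u(2)[of 0] by auto
  then have LM: "0 \<le> L + M" using L by simp
  have vL: "\<bar>v n x - v n y\<bar> \<le> (L + M) * \<bar>x - y\<bar>" for n x y
    using field_differentiable_bound[of UNIV "v n" "v' n" "L + M" x y] v(1,3) by auto
  have uc: "continuous_on UNIV u" by (rule lipschitz_imp_continuous_on_UNIV[OF u(1)])
  have vc: "continuous_on UNIV (v n)" for n by (rule lipschitz_imp_continuous_on_UNIV[OF vL])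
  have [measurable]: "u \<in> borel_measurable borel" "v n \<in> borel_measurable borel" for n
    by (auto intro!: borel_measurable_continuous_onI uc vc)
  have mm: "(\<lambda>r. marchaud s w r) \<in> borel_measurable borel" if [measurable]: "w \<in> borel_measurable borel" for w
    unfolding marchaud_def by measurable
  note [measurable] = mm
  define \<Lambda> where "\<Lambda> = (\<integral>h. marchaud_dom s (L + M) (2 * M) h \<partial>lborel)"
  have bd: "\<bar>marchaud s (v n) r\<bar> \<le> \<Lambda>" for n r
    unfolding \<Lambda>_def by (rule marchaud_bound[OF s LM M vL v(4)])
  have conv: "(\<lambda>n. marchaud s (v n) r) \<longlonglongrightarrow> marchaud s u r" for r
    unfolding marchaud_def
  proof (rule integral_dominated_convergence)
    show "integrable lborel (marchaud_dom s (L + M) (2 * M))"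
      using marchaud_dom_integrable[OF s LM] M by simp
    show "AE h in lborel. norm (indicator {0<..} h * (h powr (-1 - s) * (v n (r + h) - v n r)))
        \<le> marchaud_dom s (L + M) (2 * M) h" for n
      by (intro AE_I2 marchaud_integrand_bound vL v(4))
    show "AE h in lborel. (\<lambda>n. indicator {0<..} h * (h powr (-1 - s) * (v n (r + h) - v n r)))
        \<longlonglongrightarrow> indicator {0<..} h * (h powr (-1 - s) * (u (r + h) - u r))"
      by (intro AE_I2 tendsto_intros v(7))
  qed measurable
  have "(\<lambda>n. \<integral>r. riesz_diff s a b r * marchaud s (v n) r \<partial>lborel)
      \<longlonglongrightarrow> (\<integral>r. riesz_diff s a b r * marchaud s u r \<partial>lborel)"
  proof (rule integral_dominated_convergence)
    show "integrable lborel (\<lambda>r. \<bar>riesz_diff s a b r\<bar> * \<Lambda>)"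
      using riesz_diff_integrable[OF s ba] by simp
    show "AE r in lborel. norm (riesz_diff s a b r * marchaud s (v n) r) \<le> \<bar>riesz_diff s a b r\<bar> * \<Lambda>" for n
      using bd by (intro AE_I2) (auto simp: abs_mult intro!: mult_left_mono)
    show "AE r in lborel. (\<lambda>n. riesz_diff s a b r * marchaud s (v n) r) \<longlonglongrightarrow> riesz_diff s a b r * marchaud s u r"
      by (intro AE_I2 tendsto_intros conv)
  qed measurable
  moreover have "(\<integral>r. riesz_diff s a b r * marchaud s (v n) r \<partial>lborel)
      = - (Gamma s * Gamma (1 - s) / s) * (v n a - v n b)" for n
  proof -
    have "has_bochner_integral lborel (\<lambda>r. indicator {c<..} r * ((r - c) powr (s - 1) * marchaud s (v n) r))
        (- (Gamma s * Gamma (1 - s) / s) * v n c)" for c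
      using marchaud_fractional_integral_C1[OF s v(1)[of n] v(2)[of n] v(3)[of n] v(4)[of n], of "real n" c]
        v(5)[of n] v(6)[of n] by blast
    from has_bochner_integral_diff[OF this[of a] this[of b]]
    have "has_bochner_integral lborel (\<lambda>r. riesz_diff s a b r * marchaud s (v n) r)
        (- (Gamma s * Gamma (1 - s) / s) * v n a - - (Gamma s * Gamma (1 - s) / s) * v n b)"
      by (simp add: riesz_diff_def algebra_simps)
    then show ?thesis by (simp only: has_bochner_integral_iff right_diff_distrib)
  qed
  ultimately have "(\<lambda>n. - (Gamma s * Gamma (1 - s) / s) * (v n a - v n b))
      \<longlonglongrightarrow> (\<integral>r. riesz_diff s a b r * marchaud s u r \<partial>lborel)"
    by simp
  moreover have "(\<lambda>n. - (Gamma s * Gamma (1 - s) / s) * (v n a - v n b))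
      \<longlonglongrightarrow> - (Gamma s * Gamma (1 - s) / s) * (u a - u b)"
    by (intro tendsto_intros v(7))
  ultimately show ?thesis by (rule LIMSEQ_unique)
qed

section \<open>The Kolmogorov semigroup\<close>

locale kolmogorov =
  fixes Q B :: "real^'n^'n"
  assumes Q_symmetric: "transpose Q = Q" and K_pos_def: "\<And>t. 0 < t \<Longrightarrow> pos_def_mat (Kmat Q B t)"
begin

abbreviation flow :: "real \<Rightarrow> real^'n^'n" where "flow t \<equiv> mexp (t *\<^sub>R B)"

abbreviation heat :: "real \<Rightarrow> real^'n \<Rightarrow> real" where "heat t \<equiv> gauss_dens (covmat Q B t)"

lemma Kmat_covmat: "Kmat Q B t = (1 / t) *\<^sub>R covmat Q B t"
  by (simp add: Kmat_def covmat_def)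

lemma covmat_scale: "0 < t \<Longrightarrow> t *\<^sub>R Kmat Q B t = covmat Q B t"
  by (simp add: Kmat_covmat)

lemma covmat_pos_def:
  assumes "0 < t"
  shows "pos_def_mat (covmat Q B t)"
  unfolding pos_def_mat_def
proof (intro allI impI)
  fix x :: "real^'n" assume x: "x \<noteq> 0"
  have "0 < x \<bullet> (Kmat Q B t *v x)" using K_pos_def[OF assms] x by (simp add: pos_def_mat_def)
  also have "\<dots> = (1 / t) * (x \<bullet> (covmat Q B t *v x))"
    unfolding Kmat_covmat by (simp add: bounded_bilinear.scaleR_left[OF bounded_bilinear_matrix_vector_mult])
  finally show "0 < x \<bullet> (covmat Q B t *v x)" using assms by (simp add: zero_less_divide_iff)
qed

lemmas covmat_spd = covmat_symmetric[OF Q_symmetric] covmat_pos_def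

text \<open>Since K(t) = C/t, its inverse is t times the inverse of C, and this t cancels the one in
  the exponent. The kernel becomes a translate of one fixed Gaussian.\<close>

lemma pker_eq_heat:
  assumes "0 < t"
  shows "pker Q B X Y t = heat t (Y - flow t *v X)"
proof -
  have "Kmat Q B t ** (t *\<^sub>R matrix_inv (covmat Q B t)) = mat 1"
    using assms matrix_inv_covariance(2)[OF covmat_spd(1) covmat_spd(2)[OF assms]]
    by (simp add: Kmat_covmat bounded_bilinear.scaleR_left[OF bounded_bilinear_matrix_matrix_mult]
        bounded_bilinear.scaleR_right[OF bounded_bilinear_matrix_matrix_mult])
  then have "matrix_inv (Kmat Q B t) = t *\<^sub>R matrix_inv (covmat Q B t)"
    by (rule matrix_inv_eqI)
  then show ?thesis
    unfolding pker_def msq_def gauss_dens_def covmat_scale[OF assms] using assms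
    by (simp add: bounded_bilinear.scaleR_left[OF bounded_bilinear_matrix_vector_mult])
qed

lemma heat_has_integral:
  assumes "0 < t"
  shows "has_bochner_integral lborel (heat t) 1"
  by (rule has_bochner_integral_nn_integral)
    (auto simp: gauss_dens_nonneg nn_integral_gauss_dens[OF covmat_spd(1) covmat_spd(2)[OF assms]])

lemma heat_shift_integrable:
  assumes "0 < t"
  shows "integrable lborel (\<lambda>Y. heat t (Y - a))" "(\<integral>Y. heat t (Y - a) \<partial>lborel) = 1"
proof -
  have *: "has_bochner_integral lborel (\<lambda>Y. heat t (Y - a)) 1"
  proof (rule has_bochner_integral_nn_integral)
    show "(\<integral>\<^sup>+Y. ennreal (heat t (Y - a)) \<partial>lborel) = ennreal 1"
      using nn_integral_lborel_shift[of "\<lambda>y. ennreal (heat t y)" "-a"]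
        nn_integral_gauss_dens[OF covmat_spd(1) covmat_spd(2)[OF assms]] by simp
  qed (auto simp: gauss_dens_nonneg)
  show "integrable lborel (\<lambda>Y. heat t (Y - a))" "(\<integral>Y. heat t (Y - a) \<partial>lborel) = 1"
    using * by (auto simp: has_bochner_integral_iff)
qed

lemma heat_mult_integrable:
  assumes "0 < t" and [measurable]: "f \<in> borel_measurable borel" and M: "\<And>x. \<bar>f x\<bar> \<le> M"
  shows "integrable lborel (\<lambda>Y. heat t (Y - a) * f Y)"
proof (rule Bochner_Integration.integrable_bound)
  show "integrable lborel (\<lambda>Y. heat t (Y - a) * M)"
    using heat_shift_integrable(1)[OF assms(1)] by simp
  show "AE Y in lborel. norm (heat t (Y - a) * f Y) \<le> norm (heat t (Y - a) * M)"
    using M order_trans[OF M abs_ge_self] 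
    by (intro AE_I2) (auto simp: abs_mult gauss_dens_nonneg intro!: mult_left_mono)
qed measurable

lemma Psemi_eq:
  assumes "0 < t"
  shows "Psemi Q B t f X = (\<integral>Y. heat t (Y - flow t *v X) * f Y \<partial>lborel)"
  unfolding Psemi_def pker_eq_heat[OF assms] ..

lemma Psemi_eq_shift:
  assumes "0 < t" and [measurable]: "f \<in> borel_measurable borel"
  shows "Psemi Q B t f X = (\<integral>y. heat t y * f (flow t *v X + y) \<partial>lborel)"
proof -
  have "(\<integral>Y. heat t (Y - flow t *v X) * f Y \<partial>lborel)
      = (\<integral>Y. heat t (Y - flow t *v X) * f Y \<partial>distr lborel borel ((+) (flow t *v X)))"
    by (simp only: lborel_distr_plus)
  also have "\<dots> = (\<integral>y. heat t y * f (flow t *v X + y) \<partial>lborel)"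
    by (subst integral_distr) auto
  finally show ?thesis by (simp add: Psemi_eq[OF assms(1)])
qed

lemma Psemi_bound:
  assumes "0 < t" and [measurable]: "f \<in> borel_measurable borel" and M: "\<And>x. \<bar>f x\<bar> \<le> M"
  shows "\<bar>Psemi Q B t f X\<bar> \<le> M"
proof -
  have "norm (\<integral>Y. heat t (Y - flow t *v X) * f Y \<partial>lborel) \<le> (\<integral>Y. heat t (Y - flow t *v X) * M \<partial>lborel)"
    using heat_shift_integrable(1)[OF assms(1)] M
    by (intro Bochner_Integration.integral_norm_bound_integral heat_mult_integrable[OF assms])
      (auto simp: abs_mult gauss_dens_nonneg intro!: mult_left_mono)
  then show ?thesis
    by (simp add: Psemi_eq[OF assms(1)] heat_shift_integrable(2)[OF assms(1)])
qed

lemma Psemi_diff: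
  assumes "0 < t" and f: "f \<in> borel_measurable borel" "\<And>x. \<bar>f x\<bar> \<le> M"
    and g: "g \<in> borel_measurable borel" "\<And>x. \<bar>g x\<bar> \<le> M'"
  shows "Psemi Q B t (\<lambda>x. f x - g x) X = Psemi Q B t f X - Psemi Q B t g X"
  unfolding Psemi_eq[OF assms(1)] right_diff_distrib
  by (intro Bochner_Integration.integral_diff heat_mult_integrable[OF assms(1) f] heat_mult_integrable[OF assms(1) g])

text \<open>In the shifted form, \<open>X\<close> occurs only inside the argument of
  \<open>f\<close>, with majorant \<open>heat t y * M\<close>. The continuity serves to make P_h f
  measurable when the semigroup is applied again.\<close>

lemma Psemi_continuous:
  assumes "0 < t" and f: "continuous_on UNIV f" and M: "\<And>x. \<bar>f x\<bar> \<le> M"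
  shows "continuous_on UNIV (Psemi Q B t f)"
proof -
  have [measurable]: "f \<in> borel_measurable borel" by (intro borel_measurable_continuous_onI f)
  have "continuous (at X) (Psemi Q B t f)" for X
    unfolding continuous_at_sequentially
  proof (intro allI impI)
    fix Z assume Z: "Z \<longlonglongrightarrow> X"
    have "(\<lambda>n. \<integral>y. heat t y * f (flow t *v Z n + y) \<partial>lborel)
        \<longlonglongrightarrow> (\<integral>y. heat t y * f (flow t *v X + y) \<partial>lborel)"
    proof (rule integral_dominated_convergence)
      show "integrable lborel (\<lambda>y. heat t y * M)"
        using heat_has_integral[OF assms(1)] by (simp add: has_bochner_integral_iff)
      show "AE y in lborel. norm (heat t y * f (flow t *v Z n + y)) \<le> heat t y * M" for n
        using M by (intro AE_I2) (auto simp: abs_mult gauss_dens_nonneg intro!: mult_left_mono)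
      show "AE y in lborel. (\<lambda>n. heat t y * f (flow t *v Z n + y)) \<longlonglongrightarrow> heat t y * f (flow t *v X + y)"
      proof (intro AE_I2 tendsto_mult tendsto_const)
        fix y
        have "(\<lambda>n. flow t *v Z n + y) \<longlonglongrightarrow> flow t *v X + y"
          by (intro tendsto_intros bounded_bilinear.tendsto[OF bounded_bilinear_matrix_vector_mult] Z)
        then show "(\<lambda>n. f (flow t *v Z n + y)) \<longlonglongrightarrow> f (flow t *v X + y)"
          using f by (auto intro: continuous_on_tendsto_compose)
      qed
    qed measurable
    then show "(Psemi Q B t f \<circ> Z) \<longlonglongrightarrow> Psemi Q B t f X"
      by (simp add: Psemi_eq_shift[OF assms(1)] o_def)
  qed
  then show ?thesis by (simp add: continuous_on_eq_continuous_at)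
qed

text \<open>Centring at the transported point reduces this to the Gaussian convolution with
  \<open>E = flow r\<close>; \<open>covmat_add\<close> is exactly the covariance identity which that
  convolution demands.\<close>

lemma heat_chapman_kolmogorov:
  assumes "0 < t" "0 < r"
  shows "(\<integral>\<^sup>+Z. ennreal (heat t (Z - flow t *v X) * heat r (Y - flow r *v Z)) \<partial>lborel)
    = ennreal (heat (r + t) (Y - flow (r + t) *v X))"
proof -
  have "(\<integral>\<^sup>+Z. ennreal (heat t (Z - flow t *v X) * heat r (Y - flow r *v Z)) \<partial>lborel)
      = (\<integral>\<^sup>+W. ennreal (heat t ((flow t *v X + W) - flow t *v X) * heat r (Y - flow r *v (flow t *v X + W))) \<partial>lborel)"
    by (rule nn_integral_lborel_shift[symmetric]) measurable
  also have "\<dots> = (\<integral>\<^sup>+W. ennreal (heat t W * heat r ((Y - flow (r + t) *v X) - flow r *v W)) \<partial>lborel)"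
    by (simp add: mexp_add matrix_vector_right_distrib matrix_vector_mul_assoc diff_diff_eq)
  also have "\<dots> = ennreal (heat (r + t) (Y - flow (r + t) *v X))"
    using assms by (intro gauss_dens_convolution covmat_spd covmat_add) auto
  finally show ?thesis .
qed

text \<open>Fubini brings the intermediate point inside, where Chapman-Kolmogorov evaluates the
  integral; the same identity with |f| \<le> M gives absolute integrability.\<close>

lemma Psemi_semigroup:
  assumes t: "0 < t" and r: "0 < r" and [measurable]: "f \<in> borel_measurable borel" and M: "\<And>x. \<bar>f x\<bar> \<le> M"
  shows "Psemi Q B t (Psemi Q B r f) X = Psemi Q B (r + t) f X"
proof -
  define G where "G Z Y = heat t (Z - flow t *v X) * heat r (Y - flow r *v Z)" for Z Y
  have [measurable]: "(\<lambda>p. heat r (snd p - flow r *v fst p)) \<in> borel_measurable (borel \<Otimes>\<^sub>M borel)"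
    by (rule measurable_compose[OF _ gauss_dens_measurable]) measurable
  have Gm [measurable]: "(\<lambda>p. G (fst p) (snd p)) \<in> borel_measurable (borel \<Otimes>\<^sub>M borel)"
    unfolding G_def by measurable
  have G0: "0 \<le> G Z Y" for Z Y by (simp add: G_def gauss_dens_nonneg)
  have Gint: "has_bochner_integral lborel (\<lambda>Z. G Z Y) (heat (r + t) (Y - flow (r + t) *v X))" for Y
    by (rule has_bochner_integral_nn_integral)
      (use heat_chapman_kolmogorov[OF t r] in \<open>auto simp: G_def gauss_dens_nonneg\<close>)
  have intG: "integrable (lborel \<Otimes>\<^sub>M lborel) (\<lambda>(Z, Y). G Z Y * f Y)"
  proof (rule integrableI_bounded)
    have "(\<integral>\<^sup>+p. ennreal (norm (case p of (Z, Y) \<Rightarrow> G Z Y * f Y)) \<partial>(lborel \<Otimes>\<^sub>M lborel))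
        = (\<integral>\<^sup>+Y. \<integral>\<^sup>+Z. ennreal (norm (G Z Y * f Y)) \<partial>lborel \<partial>lborel)"
      by (subst lborel_pair.nn_integral_snd[symmetric]) (auto simp: case_prod_beta)
    also have "\<dots> \<le> (\<integral>\<^sup>+Y. ennreal (heat (r + t) (Y - flow (r + t) *v X)) * ennreal M \<partial>lborel)"
    proof (rule nn_integral_mono)
      fix Y
      have [measurable]: "(\<lambda>Z. G Z Y) \<in> borel_measurable borel" unfolding G_def by measurable
      have "(\<integral>\<^sup>+Z. ennreal (norm (G Z Y * f Y)) \<partial>lborel) \<le> (\<integral>\<^sup>+Z. ennreal (G Z Y) * ennreal M \<partial>lborel)"
        using M G0 order_trans[OF abs_ge_zero M]
        by (intro nn_integral_mono) (auto simp: abs_mult ennreal_mult[symmetric] intro!: ennreal_leI mult_left_mono)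
      also have "\<dots> = ennreal (heat (r + t) (Y - flow (r + t) *v X)) * ennreal M"
        by (subst nn_integral_multc) (auto simp: G_def heat_chapman_kolmogorov[OF t r])
      finally show "(\<integral>\<^sup>+Z. ennreal (norm (G Z Y * f Y)) \<partial>lborel)
         \<le> ennreal (heat (r + t) (Y - flow (r + t) *v X)) * ennreal M" .
    qed
    also have "\<dots> = (\<integral>\<^sup>+Y. ennreal (heat (r + t) (Y - flow (r + t) *v X)) \<partial>lborel) * ennreal M"
      by (rule nn_integral_multc) measurable
    also have "\<dots> < \<infinity>"
      using nn_integral_eq_integral[OF heat_shift_integrable(1)[of "r + t" "flow (r + t) *v X"]] t r
      by (simp add: gauss_dens_nonneg heat_shift_integrable(2))
    finally show "(\<integral>\<^sup>+p. ennreal (norm (case p of (Z, Y) \<Rightarrow> G Z Y * f Y)) \<partial>(lborel \<Otimes>\<^sub>M lborel)) < \<infinity>" .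
  qed (unfold case_prod_beta, measurable)
  have "Psemi Q B t (Psemi Q B r f) X
      = (\<integral>Z. heat t (Z - flow t *v X) * (\<integral>Y. heat r (Y - flow r *v Z) * f Y \<partial>lborel) \<partial>lborel)"
    by (simp add: Psemi_eq t r)
  also have "\<dots> = (\<integral>Z. (\<integral>Y. G Z Y * f Y \<partial>lborel) \<partial>lborel)"
    by (simp add: G_def mult.assoc)
  also have "\<dots> = (\<integral>Y. (\<integral>Z. G Z Y * f Y \<partial>lborel) \<partial>lborel)"
    using lborel_pair.Fubini_integral[OF intG] by simp
  also have "\<dots> = (\<integral>Y. heat (r + t) (Y - flow (r + t) *v X) * f Y \<partial>lborel)"
    using Gint by (simp add: has_bochner_integral_iff)
  also have "\<dots> = Psemi Q B (r + t) f X"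
    using t r by (simp add: Psemi_eq)
  finally show ?thesis .
qed

end

section \<open>Time regularity on Schwartz functions\<close>

text \<open>The Schwartz bounds concern derivatives along the axes; expanding the direction in the
  basis transfers them to the Frechet derivative.\<close>

lemma derivative_eq_sum_partials:
  fixes g :: "real^'n \<Rightarrow> real"
  assumes "g differentiable (at x)"
  shows "frechet_derivative g (at x) y = (\<Sum>i\<in>UNIV. y $ i * frechet_derivative g (at x) (axis i 1))"
proof -
  interpret linear "frechet_derivative g (at x)"
    using linear_frechet_derivative[OF assms] .
  have "frechet_derivative g (at x) y = frechet_derivative g (at x) (\<Sum>i\<in>UNIV. y $ i *\<^sub>R axis i 1)"
    using basis_expansion[of y] by (simp add: scalar_mult_eq_scaleR)
  then show ?thesis by (simp add: sum scaleR)
qed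

lemma derivative_partials_bound:
  fixes g :: "real^'n \<Rightarrow> real"
  assumes "g differentiable (at x)" "\<And>i. \<bar>frechet_derivative g (at x) (axis i 1)\<bar> \<le> K"
  shows "\<bar>frechet_derivative g (at x) y\<bar> \<le> real CARD('n) * K * norm y"
proof -
  have "\<bar>frechet_derivative g (at x) y\<bar> \<le> (\<Sum>i\<in>UNIV. \<bar>y $ i * frechet_derivative g (at x) (axis i 1)\<bar>)"
    unfolding derivative_eq_sum_partials[OF assms(1), of y] by (rule sum_abs)
  also have "\<dots> \<le> (\<Sum>i\<in>(UNIV :: 'n set). norm y * K)"
    using assms(2) component_le_norm_cart[of y] by (intro sum_mono) (auto simp: abs_mult intro!: mult_mono)
  finally show ?thesis by (simp add: mult_ac)
qed

lemma partials_bound_imp_lipschitz: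
  fixes g :: "real^'n \<Rightarrow> real"
  assumes "\<And>x. g differentiable (at x)" "\<And>x i. \<bar>frechet_derivative g (at x) (axis i 1)\<bar> \<le> K"
  shows "\<bar>g x - g y\<bar> \<le> real CARD('n) * K * norm (x - y)"
proof -
  have "norm (g x - g y) \<le> real CARD('n) * K * norm (x - y)"
  proof (rule differentiable_bound[of UNIV g "\<lambda>x. frechet_derivative g (at x)"])
    show "(g has_derivative frechet_derivative g (at x)) (at x within UNIV)" for x
      using assms(1) by (simp add: frechet_derivative_works[symmetric])
    show "onorm (frechet_derivative g (at x)) \<le> real CARD('n) * K" for x
      using derivative_partials_bound[OF assms] by (intro onorm_le) auto
  qed auto
  then show ?thesis by simp
qed

lemma schwartz_differentiable: "schwartz f \<Longrightarrow> pderivs is f differentiable (at x)"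
  by (simp add: schwartz_def)

lemma schwartz_bound:
  assumes "schwartz f"
  obtains C where "0 \<le> C" "\<And>x. (1 + norm x) ^ k * \<bar>pderivs is f x\<bar> \<le> C"
proof -
  obtain C where C: "\<And>x. (1 + norm x) ^ k * \<bar>pderivs is f x\<bar> \<le> C"
    using assms unfolding schwartz_def by blast
  have "0 \<le> (1 + norm (0 :: real^'a)) ^ k * \<bar>pderivs is f 0\<bar>" by simp
  then have "0 \<le> C" using C[of 0] by linarith
  with C that show ?thesis by blast
qed

lemma schwartz_bound_index:
  fixes P :: "'n::finite \<Rightarrow> 'n list"
  assumes "schwartz f"
  obtains C where "0 \<le> C" "\<And>i x. (1 + norm x) ^ k * \<bar>pderivs (P i) f x\<bar> \<le> C"
proof -
  have "\<forall>i. \<exists>C. 0 \<le> C \<and> (\<forall>x. (1 + norm x) ^ k * \<bar>pderivs (P i) f x\<bar> \<le> C)"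
    using schwartz_bound[OF assms] by metis
  then obtain C where C: "\<And>i. 0 \<le> C i" "\<And>i x. (1 + norm x) ^ k * \<bar>pderivs (P i) f x\<bar> \<le> C i"
    by metis
  show ?thesis
  proof (rule that)
    show "0 \<le> (\<Sum>i\<in>UNIV. C i)" using C(1) by (rule sum_nonneg)
    show "(1 + norm x) ^ k * \<bar>pderivs (P i) f x\<bar> \<le> (\<Sum>i\<in>UNIV. C i)" for i x
      using C(2)[of x i] member_le_sum[of i UNIV C] C(1) by force
  qed
qed

lemma schwartz_continuous: "schwartz f \<Longrightarrow> continuous_on UNIV f"
  using schwartz_differentiable[of f "[]"]
  by (simp add: continuous_on_eq_continuous_at differentiable_imp_continuous_within)

lemma schwartz_bounded:
  assumes "schwartz f"
  obtains M where "0 \<le> M" "\<And>x. \<bar>f x\<bar> \<le> M"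
  using schwartz_bound[OF assms, of 0 "[]"] by auto

text \<open>The symmetric difference has no first-order term. One mean value theorem along the
  segment leaves first partials at two points at distance at most 2 |y|, and their Lipschitz bound
  supplies the second factor |y|.\<close>

lemma schwartz_second_difference:
  assumes "schwartz f"
  obtains D where "0 \<le> D" "\<And>m y. \<bar>f (m + y) + f (m - y) - 2 * f (m :: real^'n)\<bar> \<le> D * (norm y)\<^sup>2"
proof -
  have fd: "f differentiable (at x)" for x using schwartz_differentiable[OF assms, of "[]"] by simp
  have "\<exists>K\<ge>0. \<forall>j x. \<bar>pderivs [j, i] f x\<bar> \<le> K" for i
    using schwartz_bound_index[OF assms, of 0 "\<lambda>j. [j, i]"] by (metis mult_1 power_0)
  then obtain K where K: "\<And>i. 0 \<le> K i" "\<And>i j x. \<bar>pderivs [j, i] f x\<bar> \<le> K i"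
    by metis
  define N where "N = real CARD('n)"
  define \<kappa> where "\<kappa> = N * (\<Sum>i\<in>UNIV. K i)"
  have \<kappa>0: "0 \<le> \<kappa>" using K(1) by (simp add: \<kappa>_def N_def sum_nonneg)
  have lip: "\<bar>pderivs [i] f x - pderivs [i] f y\<bar> \<le> \<kappa> * norm (x - y)" for i x y
    unfolding \<kappa>_def N_def
  proof (rule partials_bound_imp_lipschitz)
    show "pderivs [i] f differentiable (at x)" for x by (rule schwartz_differentiable[OF assms])
    show "\<bar>frechet_derivative (pderivs [i] f) (at x) (axis j 1)\<bar> \<le> (\<Sum>i\<in>UNIV. K i)" for x j
      using K(2)[of j i x] member_le_sum[of i UNIV K] K(1) by force
  qed
  show ?thesis
  proof (rule that)
    show "0 \<le> N * (2 * \<kappa>)" using \<kappa>0 by (simp add: N_def)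
    fix m y :: "real^'n"
    define \<psi> where "\<psi> \<theta> = f (m + \<theta> *\<^sub>R y) + f (m - \<theta> *\<^sub>R y)" for \<theta>
    define \<psi>' where "\<psi>' \<theta> = frechet_derivative f (at (m + \<theta> *\<^sub>R y)) y - frechet_derivative f (at (m - \<theta> *\<^sub>R y)) y" for \<theta>
    have line: "((\<lambda>\<theta>. f (m + \<theta> *\<^sub>R z)) has_real_derivative frechet_derivative f (at (m + \<theta> *\<^sub>R z)) z) (at \<theta>)" for z \<theta>
    proof -
      have "(f has_derivative frechet_derivative f (at (m + \<theta> *\<^sub>R z))) (at (m + \<theta> *\<^sub>R z))"
        using fd by (simp add: frechet_derivative_works[symmetric])
      moreover have "((\<lambda>\<theta>. m + \<theta> *\<^sub>R z) has_derivative (\<lambda>h. h *\<^sub>R z)) (at \<theta>)"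
        by (auto intro!: derivative_eq_intros)
      ultimately have "((\<lambda>\<theta>. f (m + \<theta> *\<^sub>R z)) has_derivative (\<lambda>h. frechet_derivative f (at (m + \<theta> *\<^sub>R z)) (h *\<^sub>R z))) (at \<theta>)"
        using has_derivative_compose by fastforce
      then show ?thesis
        using linear_scale[OF linear_frechet_derivative[OF fd]]
        by (simp add: has_field_derivative_def mult.commute[of _ "frechet_derivative f _ _"])
    qed
    have "(\<psi> has_real_derivative \<psi>' \<theta>) (at \<theta>)" for \<theta>
    proof -
      have "(\<psi> has_real_derivative frechet_derivative f (at (m + \<theta> *\<^sub>R y)) y + frechet_derivative f (at (m + \<theta> *\<^sub>R (-y))) (-y)) (at \<theta>)"
        using DERIV_add[OF line[of y \<theta>] line[of "-y" \<theta>]] by (simp add: \<psi>_def[abs_def])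
      then show ?thesis
        using linear_neg[OF linear_frechet_derivative[OF fd]] by (simp add: \<psi>'_def)
    qed
    then obtain \<theta> where \<theta>: "0 < \<theta>" "\<theta> < 1" "\<psi> 1 - \<psi> 0 = (1 - 0) * \<psi>' \<theta>"
      using MVT2[of 0 1 \<psi> \<psi>'] by auto
    have "f (m + y) + f (m - y) - 2 * f m = \<psi>' \<theta>" using \<theta>(3) by (simp add: \<psi>_def)
    also have "\<psi>' \<theta> = (\<Sum>i\<in>UNIV. y $ i * (pderivs [i] f (m + \<theta> *\<^sub>R y) - pderivs [i] f (m - \<theta> *\<^sub>R y)))"
      unfolding \<psi>'_def derivative_eq_sum_partials[OF fd, of _ y] by (simp add: sum_subtractf right_diff_distrib)
    also have "\<bar>\<dots>\<bar> \<le> (\<Sum>i\<in>(UNIV :: 'n set). norm y * (\<kappa> * (2 * norm y)))"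
    proof (rule order_trans[OF sum_abs], rule sum_mono)
      fix i
      have "\<bar>pderivs [i] f (m + \<theta> *\<^sub>R y) - pderivs [i] f (m - \<theta> *\<^sub>R y)\<bar> \<le> \<kappa> * norm ((m + \<theta> *\<^sub>R y) - (m - \<theta> *\<^sub>R y))"
        by (rule lip)
      also have "(m + \<theta> *\<^sub>R y) - (m - \<theta> *\<^sub>R y) = (2 * \<theta>) *\<^sub>R y"
        by (simp add: scaleR_2 flip: scaleR_scaleR)
      also have "\<kappa> * norm ((2 * \<theta>) *\<^sub>R y) \<le> \<kappa> * (2 * norm y)"
        using \<theta> \<kappa>0 by (intro mult_left_mono) (auto intro!: mult_left_le_one_le)
      finally show "\<bar>y $ i * (pderivs [i] f (m + \<theta> *\<^sub>R y) - pderivs [i] f (m - \<theta> *\<^sub>R y))\<bar> \<le> norm y * (\<kappa> * (2 * norm y))"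
        unfolding abs_mult by (intro mult_mono component_le_norm_cart) auto
    qed
    also have "\<dots> = N * (2 * \<kappa>) * (norm y)\<^sup>2" by (simp add: N_def power2_eq_square)
    finally show "\<bar>f (m + y) + f (m - y) - 2 * f m\<bar> \<le> N * (2 * \<kappa>) * (norm y)\<^sup>2" .
  qed
qed

text \<open>Along the flow the derivative is the drift term (grad f(Y), B Y). The factor B Y is
  unbounded in Y, and the weight 1 + |Y| in the Schwartz bound for first partials compensates for
  its growth, so the constant is uniform in X.\<close>

lemma schwartz_flow_lipschitz:
  fixes B :: "real^'n^'n"
  assumes "schwartz f"
  obtains L where "0 \<le> L" "\<And>h X. 0 < h \<Longrightarrow> \<bar>f (mexp (h *\<^sub>R B) *v X) - f X\<bar> \<le> L * h"
proof -
  have fd: "f differentiable (at x)" for x using schwartz_differentiable[OF assms, of "[]"] by simp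
  obtain C where C: "0 \<le> C" "\<And>i x. (1 + norm x) ^ 1 * \<bar>pderivs [i] f x\<bar> \<le> C"
    using schwartz_bound_index[OF assms, of 1 "\<lambda>i. [i]"] by blast
  define L where "L = real CARD('n) * (norm B * C)"
  have drift: "\<bar>frechet_derivative f (at Y) (B *v Y)\<bar> \<le> L" for Y
  proof -
    have "\<bar>frechet_derivative f (at Y) (B *v Y)\<bar> \<le> (\<Sum>i\<in>UNIV. \<bar>(B *v Y) $ i * pderivs [i] f Y\<bar>)"
      unfolding derivative_eq_sum_partials[OF fd, of Y "B *v Y"] pderivs.simps by (rule sum_abs)
    also have "\<dots> \<le> (\<Sum>i\<in>(UNIV :: 'n set). norm B * C)"
    proof (rule sum_mono)
      fix i
      have "\<bar>(B *v Y) $ i * pderivs [i] f Y\<bar> \<le> (norm B * norm Y) * \<bar>pderivs [i] f Y\<bar>"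
        unfolding abs_mult
        by (intro mult_right_mono order_trans[OF component_le_norm_cart norm_matrix_vector_mult_Frobenius]) auto
      also have "\<dots> \<le> norm B * ((1 + norm Y) ^ 1 * \<bar>pderivs [i] f Y\<bar>)"
        unfolding mult.assoc by (intro mult_left_mono mult_right_mono) auto
      also have "\<dots> \<le> norm B * C" by (intro mult_left_mono C) auto
      finally show "\<bar>(B *v Y) $ i * pderivs [i] f Y\<bar> \<le> norm B * C" .
    qed
    finally show ?thesis by (simp add: L_def)
  qed
  show ?thesis
  proof (rule that)
    show "0 \<le> L" using C(1) by (simp add: L_def)
    fix h :: real and X :: "real^'n" assume h: "0 < h"
    have d: "((\<lambda>r. f (mexp (r *\<^sub>R B) *v X)) has_real_derivative
        frechet_derivative f (at (mexp (r *\<^sub>R B) *v X)) (B *v (mexp (r *\<^sub>R B) *v X))) (at r)" for r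
    proof -
      let ?Y = "mexp (r *\<^sub>R B) *v X"
      have 1: "(f has_derivative frechet_derivative f (at ?Y)) (at ?Y)"
        using fd by (simp add: frechet_derivative_works[symmetric])
      have "((\<lambda>r. mexp (r *\<^sub>R B) *v X) has_vector_derivative (B ** mexp (r *\<^sub>R B)) *v X) (at r)"
        by (rule bounded_linear.has_vector_derivative[OF bounded_bilinear.bounded_linear_left[OF bounded_bilinear_matrix_vector_mult] mexp_has_derivative])
      then have 2: "((\<lambda>r. mexp (r *\<^sub>R B) *v X) has_derivative (\<lambda>h. h *\<^sub>R (B *v ?Y))) (at r)"
        by (simp add: has_vector_derivative_def matrix_vector_mul_assoc)
      show ?thesis
        using has_derivative_compose[OF 2 1] linear_scale[OF linear_frechet_derivative[OF fd]]
        by (simp add: has_field_derivative_def mult.commute[of _ "frechet_derivative f _ _"])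
    qed
    obtain z where "f (mexp (h *\<^sub>R B) *v X) - f (mexp (0 *\<^sub>R B) *v X)
       = (h - 0) * frechet_derivative f (at (mexp (z *\<^sub>R B) *v X)) (B *v (mexp (z *\<^sub>R B) *v X))"
      using MVT2[OF h d] by blast
    then have "\<bar>f (mexp (h *\<^sub>R B) *v X) - f X\<bar> \<le> h * L"
      using h drift by (simp add: abs_mult mult_left_mono)
    then show "\<bar>f (mexp (h *\<^sub>R B) *v X) - f X\<bar> \<le> L * h" by (simp add: mult.commute)
  qed
qed

lemma lborel_integral_uminus:
  fixes F :: "'a::euclidean_space \<Rightarrow> real"
  assumes [measurable]: "F \<in> borel_measurable borel"
  shows "(\<integral>y. F (- y) \<partial>lborel) = (\<integral>y. F y \<partial>lborel)"
proof -
  have "lborel = distr lborel borel (\<lambda>x :: 'a. - x)"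
    using lborel_affine[of "-1" "0 :: 'a"] by (simp add: density_1)
  then have "(\<integral>y. F y \<partial>lborel) = (\<integral>y. F y \<partial>distr lborel borel (\<lambda>x :: 'a. - x))"
    by simp
  then show ?thesis by (simp add: integral_distr)
qed

section \<open>Lipschitz continuity in time of the semigroup\<close>

context kolmogorov
begin

text \<open>Separate diffusion from drift at the transported point \<open>m\<close>: the drift part
  is the flow estimate, and the diffusion part is an average of symmetric second differences,
  controlled by the second moment, which is O(h).\<close>

lemma Psemi_short_time:
  assumes f: "schwartz f"
  obtains L where "0 \<le> L" "\<And>h X. 0 < h \<Longrightarrow> h \<le> 1 \<Longrightarrow> \<bar>Psemi Q B h f X - f X\<bar> \<le> L * h"
proof -
  obtain D where D: "0 \<le> D" "\<And>m y. \<bar>f (m + y) + f (m - y) - 2 * f (m :: real^'n)\<bar> \<le> D * (norm y)\<^sup>2"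
    using schwartz_second_difference[OF f] by blast
  obtain L1 where L1: "0 \<le> L1" "\<And>h X. 0 < h \<Longrightarrow> \<bar>f (flow h *v X) - f X\<bar> \<le> L1 * h"
    using schwartz_flow_lipschitz[OF f, of B] by blast
  obtain c where c: "0 \<le> c" "\<And>h. 0 \<le> h \<Longrightarrow> h \<le> 1 \<Longrightarrow> norm (covmat Q B h) \<le> c * h"
    using covmat_linear_bound[of Q B] by blast
  obtain \<mu> where \<mu>: "0 \<le> \<mu>" "\<And>C :: real^'n^'n. transpose C = C \<Longrightarrow> pos_def_mat C \<Longrightarrow>
      (\<integral>\<^sup>+y. ennreal (gauss_dens C y * (norm y)\<^sup>2) \<partial>lborel) \<le> ennreal (\<mu> * norm C)"
    using gauss_dens_second_moment by blast
  obtain M where M: "\<And>x. \<bar>f x\<bar> \<le> M" using schwartz_bounded[OF f] by blast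
  have [measurable]: "f \<in> borel_measurable borel"
    by (intro borel_measurable_continuous_onI schwartz_continuous f)
  show ?thesis
  proof (rule that)
    show "0 \<le> D * (\<mu> * c) + L1" using D(1) \<mu>(1) c(1) L1(1) by simp
    fix h :: real and X :: "real^'n" assume h: "0 < h" "h \<le> 1"
    define m where "m = flow h *v X"
    have mom: "(\<integral>\<^sup>+y. ennreal (heat h y * (norm y)\<^sup>2) \<partial>lborel) \<le> ennreal (\<mu> * (c * h))"
      by (rule order_trans[OF \<mu>(2)[OF covmat_spd(1) covmat_spd(2)[OF h(1)]]])
        (use c(2)[of h] h \<mu>(1) in \<open>auto intro!: ennreal_leI mult_left_mono\<close>)
    have mi: "integrable lborel (\<lambda>y. heat h y * (norm y)\<^sup>2)"
      by (rule integrableI_bounded) (use mom in \<open>auto simp: gauss_dens_nonneg intro: le_less_trans\<close>)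
    have mle: "(\<integral>y. heat h y * (norm y)\<^sup>2 \<partial>lborel) \<le> \<mu> * (c * h)"
      using mom nn_integral_eq_integral[OF mi] \<mu>(1) c(1) h by (simp add: gauss_dens_nonneg)
    have hi: "integrable lborel (heat h)" "(\<integral>y. heat h y \<partial>lborel) = 1"
      using heat_has_integral[OF h(1)] by (auto simp: has_bochner_integral_iff)
    have i: "integrable lborel (\<lambda>y. heat h y * f (m + y))" "integrable lborel (\<lambda>y. heat h y * f (m - y))"
      by (rule Bochner_Integration.integrable_bound[of _ "\<lambda>y. heat h y * M"];
          use hi M order_trans[OF M abs_ge_self] in
            \<open>auto simp: abs_mult gauss_dens_nonneg intro!: mult_left_mono\<close>)+
    have P1: "Psemi Q B h f X = (\<integral>y. heat h y * f (m + y) \<partial>lborel)"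
      by (simp add: Psemi_eq_shift h m_def)
    also have "\<dots> = (\<integral>y. heat h y * f (m - y) \<partial>lborel)"
      using lborel_integral_uminus[of "\<lambda>y. heat h y * f (m + y)"] by (simp add: gauss_dens_even)
    finally have P2: "Psemi Q B h f X = (\<integral>y. heat h y * f (m - y) \<partial>lborel)" .
    \<comment> \<open>Evenness of the density gives two formulas for the same value; adding them
      symmetrises the integrand and removes the first-order term.\<close>
    have "2 * (Psemi Q B h f X - f m) = (\<integral>y. heat h y * f (m + y) + heat h y * f (m - y) - heat h y * (2 * f m) \<partial>lborel)"
      using i hi P1 P2 by simp
    also have "\<dots> = (\<integral>y. heat h y * (f (m + y) + f (m - y) - 2 * f m) \<partial>lborel)"
      by (simp add: algebra_simps)
    also have "\<bar>\<dots>\<bar> \<le> (\<integral>y. D * (heat h y * (norm y)\<^sup>2) \<partial>lborel)"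
      unfolding real_norm_def[symmetric]
    proof (rule Bochner_Integration.integral_norm_bound_integral)
      show "integrable lborel (\<lambda>y. heat h y * (f (m + y) + f (m - y) - 2 * f m))"
        using i hi by (simp add: distrib_left right_diff_distrib)
      show "integrable lborel (\<lambda>y. D * (heat h y * (norm y)\<^sup>2))" using mi by simp
      show "norm (heat h y * (f (m + y) + f (m - y) - 2 * f m)) \<le> D * (heat h y * (norm y)\<^sup>2)" for y
        using mult_left_mono[OF D(2)[of m y] gauss_dens_nonneg[of "covmat Q B h" y]]
        by (simp add: abs_mult gauss_dens_nonneg mult_ac)
    qed
    also have "\<dots> \<le> D * (\<mu> * (c * h))" using mle D(1) by (simp add: mult_left_mono)
    finally have "2 * \<bar>Psemi Q B h f X - f m\<bar> \<le> D * (\<mu> * (c * h))" 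
      by (simp only: abs_mult abs_numeral)
    then have "\<bar>Psemi Q B h f X - f m\<bar> \<le> D * (\<mu> * (c * h))"
      by (rule order_trans[rotated]) simp
    moreover have "\<bar>f m - f X\<bar> \<le> L1 * h" unfolding m_def by (rule L1(2)[OF h(1)])
    ultimately have "\<bar>(Psemi Q B h f X - f m) + (f m - f X)\<bar> \<le> D * (\<mu> * (c * h)) + L1 * h"
      by (intro order_trans[OF abs_triangle_ineq] add_mono)
    then show "\<bar>Psemi Q B h f X - f X\<bar> \<le> (D * (\<mu> * c) + L1) * h" by (simp add: algebra_simps)
  qed
qed

text \<open>Writing \<open>P_(r+h) f - P_r f = P_r (P_h f - f)\<close>, contractivity on bounded functions
  propagates the short-time bound to all times.\<close>

lemma Psemi_time_lipschitz:
  assumes f: "schwartz f"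
  obtains L where "0 \<le> L"
    "\<And>x y X. 0 < x \<Longrightarrow> 0 < y \<Longrightarrow> \<bar>Psemi Q B x f X - Psemi Q B y f X\<bar> \<le> L * \<bar>x - y\<bar>"
proof -
  obtain L where L: "0 \<le> L" "\<And>h X. 0 < h \<Longrightarrow> h \<le> 1 \<Longrightarrow> \<bar>Psemi Q B h f X - f X\<bar> \<le> L * h"
    using Psemi_short_time[OF f] by blast
  obtain M where M: "0 \<le> M" "\<And>x. \<bar>f x\<bar> \<le> M" using schwartz_bounded[OF f] by blast
  have fc: "continuous_on UNIV f" by (rule schwartz_continuous[OF f])
  have fm: "f \<in> borel_measurable borel" by (intro borel_measurable_continuous_onI fc)
  have step: "\<bar>Psemi Q B (h + r) f X - Psemi Q B r f X\<bar> \<le> (L + 2 * M) * h" if "0 < r" "0 < h" for r h X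
  proof (cases "h \<le> 1")
    case True
    have Pm: "Psemi Q B h f \<in> borel_measurable borel"
      by (intro borel_measurable_continuous_onI Psemi_continuous[OF that(2) fc M(2)])
    have "Psemi Q B (h + r) f X - Psemi Q B r f X = Psemi Q B r (Psemi Q B h f) X - Psemi Q B r f X"
      by (simp add: Psemi_semigroup[OF that fm M(2)])
    also have "\<dots> = Psemi Q B r (\<lambda>x. Psemi Q B h f x - f x) X"
      by (rule Psemi_diff[symmetric, OF that(1) Pm Psemi_bound[OF that(2) fm M(2)] fm M(2)])
    also have "\<bar>\<dots>\<bar> \<le> L * h"
      by (rule Psemi_bound[OF that(1)]) (use Pm fm L(2) that True in auto)
    also have "\<dots> \<le> (L + 2 * M) * h" using M(1) that by (intro mult_right_mono) auto
    finally show ?thesis .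
  next
    case False
    \<comment> \<open>For h > 1 boundedness is enough, since 2 M \<le> 2 M h.\<close>
    have "\<bar>Psemi Q B (h + r) f X - Psemi Q B r f X\<bar> \<le> 2 * M"
      using Psemi_bound[OF _ fm M(2), of "h + r" X] Psemi_bound[OF that(1) fm M(2), of X] that by auto
    also have "\<dots> \<le> 2 * M * h" using False M(1) mult_left_mono[of 1 h "2 * M"] by simp
    also have "\<dots> \<le> (L + 2 * M) * h" using L(1) that by (intro mult_right_mono) auto
    finally show ?thesis .
  qed
  show ?thesis
  proof (rule that)
    show "0 \<le> L + 2 * M" using L M by simp
    show "\<bar>Psemi Q B x f X - Psemi Q B y f X\<bar> \<le> (L + 2 * M) * \<bar>x - y\<bar>" if "0 < x" "0 < y" for x y X
    proof (rule linorder_cases[of x y])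
      assume "x < y" then show ?thesis using step[OF that(1), of "y - x" X] by (simp add: abs_minus_commute)
    next
      assume "y < x" then show ?thesis using step[OF that(2), of "x - y" X] by simp
    qed simp
  qed
qed

end

section \<open>Minkowski's inequality and the main estimate\<close>

text \<open>Convexity of the power, as the tangent line at \<open>A\<close> lying below the graph.
  Homogeneity reduces it to 1 + p (y - 1) \<le> y^p, which is Young's inequality with weights 1/p
  and 1 - 1/p for y^p and 1.\<close>

lemma powr_tangent_bound:
  fixes x A p :: real
  assumes "1 \<le> p" "0 \<le> x" "0 \<le> A"
  shows "A powr p + p * A powr (p - 1) * (x - A) \<le> x powr p"
proof (cases "A = 0")
  case False
  with assms have A: "0 < A" by simp
  define y where "y = x / A"
  have y: "0 \<le> y" using assms A by (simp add: y_def)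
  have "1 + p * (y - 1) \<le> y powr p"
  proof (cases "y = 0")
    case False
    have "(y powr p) powr (1 / p) * 1 powr (1 - 1 / p) \<le> (1 / p) * (y powr p) + (1 - 1 / p) * 1"
      using assms y False by (intro Youngs_inequality_0) auto
    then have "y \<le> (1 / p) * (y powr p) + (1 - 1 / p)"
      using assms y by (simp add: powr_powr)
    then have "p * y \<le> p * ((1 / p) * (y powr p) + (1 - 1 / p))"
      using assms(1) by (intro mult_left_mono) auto
    also have "\<dots> = y powr p + p - 1" using assms(1) by (simp add: field_simps)
    finally show ?thesis by (simp add: algebra_simps)
  qed (use assms(1) in simp)
  then have "A powr p * (1 + p * (y - 1)) \<le> A powr p * y powr p"
    by (intro mult_left_mono) auto
  also have "\<dots> = x powr p" using A y by (simp add: y_def powr_mult[symmetric])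
  also have "A powr p * (1 + p * (y - 1)) = A powr p + p * A powr (p - 1) * (x - A)"
  proof -
    have "A powr p = A powr (p - 1) * A" using A powr_add[of A "p - 1" 1] by simp
    then show ?thesis using A by (simp add: y_def field_simps)
  qed
  finally show ?thesis .
qed (use assms in auto)

text \<open>Integrate the tangent inequality at the weighted mean \<open>A\<close> of |G| against
  |k|: the linear term integrates to 0. The right side is stated in \<open>ennreal\<close>, ready
  for Tonelli in the space variable.\<close>

lemma weighted_jensen_powr:
  fixes k G :: "real \<Rightarrow> real"
  assumes p: "1 \<le> p" and K: "has_bochner_integral lborel (\<lambda>r. \<bar>k r\<bar>) K" "0 < K"
    and [measurable]: "k \<in> borel_measurable borel" "G \<in> borel_measurable borel"
    and G: "\<And>r. \<bar>G r\<bar> \<le> \<Lambda>"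
  shows "ennreal (\<bar>\<integral>r. k r * G r \<partial>lborel\<bar> powr p)
    \<le> ennreal (K powr (p - 1)) * (\<integral>\<^sup>+r. ennreal \<bar>k r\<bar> * ennreal (\<bar>G r\<bar> powr p) \<partial>lborel)"
proof -
  have ki: "integrable lborel (\<lambda>r. \<bar>k r\<bar>)" "(\<integral>r. \<bar>k r\<bar> \<partial>lborel) = K"
    using K(1) by (auto simp: has_bochner_integral_iff)
  have i1: "integrable lborel (\<lambda>r. \<bar>k r\<bar> * \<bar>G r\<bar>)"
    by (rule Bochner_Integration.integrable_bound[of _ "\<lambda>r. \<bar>k r\<bar> * \<Lambda>"])
      (use ki G order_trans[OF G abs_ge_self] in \<open>auto simp: abs_mult intro!: mult_left_mono\<close>)
  have i2: "integrable lborel (\<lambda>r. \<bar>k r\<bar> * \<bar>G r\<bar> powr p)"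
    by (rule Bochner_Integration.integrable_bound[of _ "\<lambda>r. \<bar>k r\<bar> * \<Lambda> powr p"])
      (use ki G p in \<open>auto simp: abs_mult intro!: mult_left_mono powr_mono2\<close>)
  define J where "J = (\<integral>r. \<bar>k r\<bar> * \<bar>G r\<bar> \<partial>lborel)"
  define A where "A = J / K"
  have J0: "0 \<le> J" unfolding J_def by (intro Bochner_Integration.integral_nonneg) auto
  have A0: "0 \<le> A" using J0 K(2) by (simp add: A_def)
  have "A powr p * K = (\<integral>r. \<bar>k r\<bar> * (A powr p - p * A powr (p - 1) * A) + p * A powr (p - 1) * (\<bar>k r\<bar> * \<bar>G r\<bar>) \<partial>lborel)"
  proof -
    have "J = A * K" using K(2) by (simp add: A_def)
    then have "A powr p * K = K * (A powr p - p * A powr (p - 1) * A) + p * A powr (p - 1) * J"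
      by (simp add: algebra_simps)
    also have "\<dots> = (\<integral>r. \<bar>k r\<bar> * (A powr p - p * A powr (p - 1) * A) + p * A powr (p - 1) * (\<bar>k r\<bar> * \<bar>G r\<bar>) \<partial>lborel)"
      using ki i1 by (simp add: J_def)
    finally show ?thesis .
  qed
  also have "\<dots> \<le> (\<integral>r. \<bar>k r\<bar> * \<bar>G r\<bar> powr p \<partial>lborel)"
  proof (rule integral_mono)
    fix r
    show "\<bar>k r\<bar> * (A powr p - p * A powr (p - 1) * A) + p * A powr (p - 1) * (\<bar>k r\<bar> * \<bar>G r\<bar>) \<le> \<bar>k r\<bar> * \<bar>G r\<bar> powr p"
      using mult_left_mono[OF powr_tangent_bound[OF p abs_ge_zero A0, of "G r"], of "\<bar>k r\<bar>"]
      by (simp add: algebra_simps)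
  qed (use ki i1 i2 in auto)
  finally have AK: "A powr p * K \<le> (\<integral>r. \<bar>k r\<bar> * \<bar>G r\<bar> powr p \<partial>lborel)" .
  have "\<bar>\<integral>r. k r * G r \<partial>lborel\<bar> \<le> J"
    unfolding J_def using integral_norm_bound[of lborel "\<lambda>r. k r * G r"] by (simp add: abs_mult)
  then have "\<bar>\<integral>r. k r * G r \<partial>lborel\<bar> powr p \<le> J powr p"
    using p by (intro powr_mono2) auto
  also have "J = A * K" using K(2) by (simp add: A_def)
  also have "(A * K) powr p = K powr (p - 1) * (A powr p * K)"
    using A0 K(2) powr_add[of K "p - 1" 1] by (simp add: powr_mult)
  also have "\<dots> \<le> K powr (p - 1) * (\<integral>r. \<bar>k r\<bar> * \<bar>G r\<bar> powr p \<partial>lborel)"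
    by (intro mult_left_mono AK) auto
  finally have "ennreal (\<bar>\<integral>r. k r * G r \<partial>lborel\<bar> powr p)
      \<le> ennreal (K powr (p - 1) * (\<integral>r. \<bar>k r\<bar> * \<bar>G r\<bar> powr p \<partial>lborel))"
    by (rule ennreal_leI)
  also have "\<dots> = ennreal (K powr (p - 1)) * (\<integral>\<^sup>+r. ennreal (\<bar>k r\<bar> * \<bar>G r\<bar> powr p) \<partial>lborel)"
    by (subst nn_integral_eq_integral[OF i2]) (auto simp: ennreal_mult')
  finally show ?thesis by (simp add: ennreal_mult')
qed

text \<open>Passes between the norm and the integral of the p-th power, on which Tonelli can act.
  For an infinite integral both sides are false.\<close>

lemma Lp_norm_le_iff:
  assumes p: "1 \<le> p" and S: "0 \<le> S"
  shows "Lp_norm p g \<le> ennreal S \<longleftrightarrow> (\<integral>\<^sup>+x. ennreal (\<bar>g x\<bar> powr p) \<partial>lborel) \<le> ennreal (S powr p)"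
proof -
  define I where "I = (\<integral>\<^sup>+x. ennreal (\<bar>g x\<bar> powr p) \<partial>lborel)"
  show ?thesis
  proof (cases I)
    case (real a)
    have "Lp_norm p g = ennreal (a powr (1 / p))"
      using real by (simp add: Lp_norm_def I_def)
    moreover have "a powr (1 / p) \<le> S \<longleftrightarrow> a \<le> S powr p"
    proof
      assume "a powr (1 / p) \<le> S"
      then have "(a powr (1 / p)) powr p \<le> S powr p" using p by (intro powr_mono2) auto
      then show "a \<le> S powr p" using p real(1) by (simp add: powr_powr)
    next
      assume "a \<le> S powr p"
      then have "a powr (1 / p) \<le> (S powr p) powr (1 / p)" using p real(1) by (intro powr_mono2) auto
      then show "a powr (1 / p) \<le> S" using p S by (simp add: powr_powr)
    qed
    ultimately show ?thesis using real S by (simp add: I_def)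
  next
    case top
    then show ?thesis by (simp add: Lp_norm_def I_def top_unique)
  qed
qed

section \<open>The Hoelder estimate in time\<close>

context kolmogorov
begin

text \<open>The semigroup law merges P_h and P_r into P_(r+h). As \<open>r\<close> exceeds
  \<open>b\<close> and the increments go forward, the freezing \<open>max\<close> is inactive;
  elsewhere it keeps the time argument positive.\<close>

lemma frac_pow_Psemi_eq_marchaud:
  assumes f: "schwartz f" and "0 < b" "b < r"
  shows "frac_pow Q B s (Psemi Q B r f) X
    = - (s / Gamma (1 - s)) * marchaud s (\<lambda>\<rho>. Psemi Q B (max \<rho> b) f X) r"
proof -
  obtain M where M: "\<And>x. \<bar>f x\<bar> \<le> M" using schwartz_bounded[OF f] by blast
  have fm: "f \<in> borel_measurable borel"
    by (intro borel_measurable_continuous_onI schwartz_continuous f)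
  have "indicator {0<..} h * (h powr (-1 - s) * (Psemi Q B h (Psemi Q B r f) X - Psemi Q B r f X))
      = indicator {0<..} h * (h powr (-1 - s) * (Psemi Q B (max (r + h) b) f X - Psemi Q B (max r b) f X))" for h
  proof (cases "0 < h")
    case True
    then show ?thesis
      using Psemi_semigroup[OF True _ fm M, of r X] assms(2,3) by (simp add: max_absorb1)
  qed simp
  then show ?thesis unfolding frac_pow_def marchaud_def by (simp only:)
qed

text \<open>A Lipschitz bound in time that is uniform in space, together with continuity in space,
  gives joint continuity, and with it the joint measurability that Tonelli needs.\<close>

lemma Psemi_time_space_continuous:
  assumes f: "schwartz f" and b: "0 < b"
  shows "continuous_on UNIV (\<lambda>q. Psemi Q B (max (fst q) b) f (snd q))"
proof -
  obtain L where L: "0 \<le> L"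
    "\<And>x y X. 0 < x \<Longrightarrow> 0 < y \<Longrightarrow> \<bar>Psemi Q B x f X - Psemi Q B y f X\<bar> \<le> L * \<bar>x - y\<bar>"
    using Psemi_time_lipschitz[OF f] by blast
  obtain M where M: "\<And>x. \<bar>f x\<bar> \<le> M" using schwartz_bounded[OF f] by blast
  have "continuous (at q) (\<lambda>q. Psemi Q B (max (fst q) b) f (snd q))" for q :: "real \<times> (real^'n)"
    unfolding continuous_at_sequentially
  proof (intro allI impI)
    fix x :: "nat \<Rightarrow> real \<times> (real^'n)" assume x: "x \<longlonglongrightarrow> q"
    have "(\<lambda>n. Psemi Q B (max (fst (x n)) b) f (snd (x n)) - Psemi Q B (max (fst q) b) f (snd (x n))) \<longlonglongrightarrow> 0"
    proof (rule Lim_null_comparison)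
      show "\<forall>\<^sub>F n in sequentially. norm (Psemi Q B (max (fst (x n)) b) f (snd (x n)) - Psemi Q B (max (fst q) b) f (snd (x n)))
          \<le> L * \<bar>max (fst (x n)) b - max (fst q) b\<bar>"
        using L(2) b by (intro always_eventually allI) auto
      have "(\<lambda>n. L * \<bar>max (fst (x n)) b - max (fst q) b\<bar>) \<longlonglongrightarrow> L * \<bar>max (fst q) b - max (fst q) b\<bar>"
        by (intro tendsto_intros x)
      then show "(\<lambda>n. L * \<bar>max (fst (x n)) b - max (fst q) b\<bar>) \<longlonglongrightarrow> 0" by simp
    qed
    moreover have "(\<lambda>n. Psemi Q B (max (fst q) b) f (snd (x n))) \<longlonglongrightarrow> Psemi Q B (max (fst q) b) f (snd q)"
    proof -
      have "continuous_on UNIV (Psemi Q B (max (fst q) b) f)"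
        by (rule Psemi_continuous[OF _ schwartz_continuous[OF f] M]) (use b in auto)
      then show ?thesis by (rule continuous_on_tendsto_compose) (auto intro!: tendsto_intros x)
    qed
    ultimately have "(\<lambda>n. (Psemi Q B (max (fst (x n)) b) f (snd (x n)) - Psemi Q B (max (fst q) b) f (snd (x n)))
        + Psemi Q B (max (fst q) b) f (snd (x n))) \<longlonglongrightarrow> 0 + Psemi Q B (max (fst q) b) f (snd q)"
      by (rule tendsto_add)
    then show "((\<lambda>q. Psemi Q B (max (fst q) b) f (snd q)) \<circ> x) \<longlonglongrightarrow> Psemi Q B (max (fst q) b) f (snd q)"
      by (simp add: o_def)
  qed
  then show ?thesis by (simp add: continuous_on_eq_continuous_at)
qed

text \<open>A real bound \<open>S\<close> replaces the supremum so that p-th powers are taken of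
  real numbers; ordering the times fixes the sign pattern of the kernel.\<close>

lemma Psemi_holder_ordered:
  assumes f: "schwartz f" and s: "0 < s" "s < 1" and p: "1 \<le> p" and b: "0 < b" "b < a"
    and S: "0 \<le> S" "\<And>\<sigma>. 0 < \<sigma> \<Longrightarrow> Lp_norm p (frac_pow Q B s (Psemi Q B \<sigma> f)) \<le> ennreal S"
  shows "Lp_norm p (\<lambda>X. Psemi Q B a f X - Psemi Q B b f X)
    \<le> ennreal (2 * (a - b) powr s / Gamma (1 + s) * S)"
proof -
  obtain L where L: "0 \<le> L"
    "\<And>x y X. 0 < x \<Longrightarrow> 0 < y \<Longrightarrow> \<bar>Psemi Q B x f X - Psemi Q B y f X\<bar> \<le> L * \<bar>x - y\<bar>"
    using Psemi_time_lipschitz[OF f] by blast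
  obtain M where M: "0 \<le> M" "\<And>x. \<bar>f x\<bar> \<le> M" using schwartz_bounded[OF f] by blast
  have fm: "f \<in> borel_measurable borel"
    by (intro borel_measurable_continuous_onI schwartz_continuous f)
  define u where "u X \<rho> = Psemi Q B (max \<rho> b) f X" for X \<rho>
  define k where "k = riesz_diff s a b"
  define K where "K = 2 * (a - b) powr s / s"
  define G where "G X r = - (s / Gamma (1 - s)) * marchaud s (u X) r" for X r
  have \<Gamma>: "0 < Gamma s" "0 < Gamma (1 - s)" using s by (simp_all add: Gamma_real_pos)
  have K0: "0 < K" using b s by (simp add: K_def)
  have uL: "\<bar>u X x - u X y\<bar> \<le> L * \<bar>x - y\<bar>" for X x y
  proof -
    have "\<bar>u X x - u X y\<bar> \<le> L * \<bar>max x b - max y b\<bar>"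
      unfolding u_def using b by (intro L(2)) auto
    also have "\<dots> \<le> L * \<bar>x - y\<bar>" using L(1) by (intro mult_left_mono) auto
    finally show ?thesis .
  qed
  have uM: "\<bar>u X x\<bar> \<le> M" for X x
    unfolding u_def using b by (intro Psemi_bound fm M) auto
  have um [measurable]: "(\<lambda>q. u (snd q) (fst q)) \<in> borel_measurable (borel \<Otimes>\<^sub>M borel)"
    unfolding u_def borel_prod
    by (intro borel_measurable_continuous_onI Psemi_time_space_continuous f b)
  have Gm [measurable]: "(\<lambda>q. G (snd q) (fst q)) \<in> borel_measurable (borel \<Otimes>\<^sub>M borel)"
  proof -
    have "(\<lambda>q. u (snd (fst q)) (fst (fst q) + snd q)) \<in> borel_measurable ((borel \<Otimes>\<^sub>M borel) \<Otimes>\<^sub>M lborel)"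
      using measurable_compose[OF _ um, of "\<lambda>q. (fst (fst q) + snd q, snd (fst q))"
          "(borel \<Otimes>\<^sub>M borel) \<Otimes>\<^sub>M lborel"] by simp
    moreover have "(\<lambda>q. u (snd (fst q)) (fst (fst q))) \<in> borel_measurable ((borel \<Otimes>\<^sub>M borel) \<Otimes>\<^sub>M lborel)"
      using measurable_compose[OF measurable_fst um] by simp
    ultimately have "(\<lambda>(q, h). indicator {0<..} h * (h powr (-1 - s) * (u (snd q) (fst q + h) - u (snd q) (fst q))))
        \<in> borel_measurable ((borel \<Otimes>\<^sub>M borel) \<Otimes>\<^sub>M lborel)"
      unfolding case_prod_beta by measurable
    from sigma_finite_measure.borel_measurable_lebesgue_integral[OF sigma_finite_lborel this]
    show ?thesis unfolding G_def marchaud_def by measurable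
  qed
  have GX [measurable]: "G X \<in> borel_measurable borel" for X
    using measurable_compose[OF _ Gm, of "\<lambda>r. (r, X)" borel] by simp
  define \<Lambda> where "\<Lambda> = (s / Gamma (1 - s)) * (\<integral>h. marchaud_dom s L (2 * M) h \<partial>lborel)"
  have GL: "\<bar>G X r\<bar> \<le> \<Lambda>" for X r
    using marchaud_bound[OF s L(1) M(1) uL uM, of X r] s \<Gamma>
    by (simp add: G_def \<Lambda>_def abs_mult mult_left_mono divide_right_mono)
  \<comment> \<open>The factor -s / Gamma(1 - s) and the inversion constant -Gamma(s) Gamma(1 - s) /
    s multiply to Gamma(s).\<close>
  have rep: "Psemi Q B a f X - Psemi Q B b f X = (1 / Gamma s) * (\<integral>r. k r * G X r \<partial>lborel)" for X
  proof -
    have "(\<integral>r. k r * G X r \<partial>lborel) = (\<integral>r. - (s / Gamma (1 - s)) * (k r * marchaud s (u X) r) \<partial>lborel)"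
      by (simp add: G_def mult_ac)
    also have "\<dots> = - (s / Gamma (1 - s)) * (- (Gamma s * Gamma (1 - s) / s) * (u X a - u X b))"
      unfolding k_def by (simp only: integral_mult_right_zero marchaud_inversion[OF s b(2) L(1) uL uM])
    also have "\<dots> = Gamma s * (u X a - u X b)" using s \<Gamma>(2)[THEN less_imp_neq] by (simp add: field_simps)
    finally show ?thesis using b \<Gamma> by (simp add: u_def max_absorb1)
  qed
  have km [measurable]: "k \<in> borel_measurable borel" by (simp add: k_def)
  have kK: "has_bochner_integral lborel (\<lambda>r. \<bar>k r\<bar>) K"
    unfolding k_def K_def by (rule riesz_diff_abs_integral[OF s b(2)])
  \<comment> \<open>For r \<le> b the kernel vanishes, so \<open>G X r\<close> has to agree with the
    fractional power only for r > b.\<close>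
  have inner: "ennreal \<bar>k r\<bar> * (\<integral>\<^sup>+X. ennreal (\<bar>G X r\<bar> powr p) \<partial>lborel) \<le> ennreal \<bar>k r\<bar> * ennreal (S powr p)" for r
  proof (cases "b < r")
    case True
    have "G X r = frac_pow Q B s (Psemi Q B r f) X" for X
      unfolding G_def u_def[abs_def] by (rule frac_pow_Psemi_eq_marchaud[symmetric, OF f b(1) True])
    moreover have "(\<integral>\<^sup>+X. ennreal (\<bar>frac_pow Q B s (Psemi Q B r f) X\<bar> powr p) \<partial>lborel) \<le> ennreal (S powr p)"
      using S(2)[of r] True b by (subst Lp_norm_le_iff[OF p S(1), symmetric]) auto
    ultimately show ?thesis by (simp add: mult_left_mono)
  next
    case False
    then show ?thesis using b by (simp add: k_def riesz_diff_def)
  qed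
  have "(\<integral>\<^sup>+X. ennreal (\<bar>Psemi Q B a f X - Psemi Q B b f X\<bar> powr p) \<partial>lborel)
      \<le> (\<integral>\<^sup>+X. ennreal ((1 / Gamma s) powr p * K powr (p - 1))
            * (\<integral>\<^sup>+r. ennreal \<bar>k r\<bar> * ennreal (\<bar>G X r\<bar> powr p) \<partial>lborel) \<partial>lborel)"
  proof (rule nn_integral_mono)
    fix X
    have "ennreal (\<bar>Psemi Q B a f X - Psemi Q B b f X\<bar> powr p)
        = ennreal ((1 / Gamma s) powr p) * ennreal (\<bar>\<integral>r. k r * G X r \<partial>lborel\<bar> powr p)"
      unfolding rep abs_mult using \<Gamma> by (simp add: powr_mult powr_divide ennreal_mult'[symmetric])
    also have "\<dots> \<le> ennreal ((1 / Gamma s) powr p) * (ennreal (K powr (p - 1))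
        * (\<integral>\<^sup>+r. ennreal \<bar>k r\<bar> * ennreal (\<bar>G X r\<bar> powr p) \<partial>lborel))"
      by (intro mult_left_mono weighted_jensen_powr[OF p kK K0 km GX GL]) auto
    finally show "ennreal (\<bar>Psemi Q B a f X - Psemi Q B b f X\<bar> powr p)
      \<le> ennreal ((1 / Gamma s) powr p * K powr (p - 1))
            * (\<integral>\<^sup>+r. ennreal \<bar>k r\<bar> * ennreal (\<bar>G X r\<bar> powr p) \<partial>lborel)"
      by (simp add: ennreal_mult' mult.assoc)
  qed
  also have "\<dots> = ennreal ((1 / Gamma s) powr p * K powr (p - 1))
      * (\<integral>\<^sup>+X. (\<integral>\<^sup>+r. ennreal \<bar>k r\<bar> * ennreal (\<bar>G X r\<bar> powr p) \<partial>lborel) \<partial>lborel)"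
    by (intro nn_integral_cmult lborel.borel_measurable_nn_integral)
      (use measurable_compose[OF measurable_pair_swap' Gm] in \<open>simp add: case_prod_beta\<close>)
  also have "(\<integral>\<^sup>+X. (\<integral>\<^sup>+r. ennreal \<bar>k r\<bar> * ennreal (\<bar>G X r\<bar> powr p) \<partial>lborel) \<partial>lborel)
      = (\<integral>\<^sup>+r. (\<integral>\<^sup>+X. ennreal \<bar>k r\<bar> * ennreal (\<bar>G X r\<bar> powr p) \<partial>lborel) \<partial>lborel)"
    by (rule lborel_pair.Fubini') (simp add: case_prod_beta)
  also have "\<dots> = (\<integral>\<^sup>+r. ennreal \<bar>k r\<bar> * (\<integral>\<^sup>+X. ennreal (\<bar>G X r\<bar> powr p) \<partial>lborel) \<partial>lborel)"
  proof (intro nn_integral_cong nn_integral_cmult)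
    fix r
    have [measurable]: "(\<lambda>X. G X r) \<in> borel_measurable borel"
      using measurable_compose[OF _ Gm, of "\<lambda>X. (r, X)" borel] by simp
    show "(\<lambda>X. ennreal (\<bar>G X r\<bar> powr p)) \<in> borel_measurable lborel" by measurable
  qed
  also have "\<dots> \<le> (\<integral>\<^sup>+r. ennreal \<bar>k r\<bar> * ennreal (S powr p) \<partial>lborel)"
    by (intro nn_integral_mono inner)
  also have "\<dots> = ennreal K * ennreal (S powr p)"
    using kK nn_integral_eq_integral[of lborel "\<lambda>r. \<bar>k r\<bar>"]
    by (subst nn_integral_multc) (auto simp: has_bochner_integral_iff)
  also have "ennreal ((1 / Gamma s) powr p * K powr (p - 1)) * (ennreal K * ennreal (S powr p))
      = ennreal ((K / Gamma s * S) powr p)"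
  \<comment> \<open>Jensen contributes K^(p-1) and the remaining kernel integral contributes K;
    together they give the p-th power of the Minkowski constant K.\<close>
  proof -
    have "K powr (p - 1) * K = K powr p" using K0 powr_add[of K "p - 1" 1] by simp
    then have "(1 / Gamma s) powr p * K powr (p - 1) * (K * S powr p) = (K / Gamma s * S) powr p"
      using K0 \<Gamma> S(1) by (simp add: powr_mult powr_divide field_simps)
    then show ?thesis using K0 by (simp add: ennreal_mult'[symmetric])
  qed
  finally have "Lp_norm p (\<lambda>X. Psemi Q B a f X - Psemi Q B b f X) \<le> ennreal (K / Gamma s * S)"
    using K0 \<Gamma> S(1) by (subst Lp_norm_le_iff[OF p]) (auto simp: mult_left_mono)
  also have "K / Gamma s = 2 * (a - b) powr s / Gamma (1 + s)"
  proof -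
    have "s \<notin> \<int>\<^sub>\<le>\<^sub>0" using s by (auto elim!: nonpos_Ints_cases)
    then have "Gamma (1 + s) = s * Gamma s" using Gamma_plus1[of s] by (simp add: add.commute)
    then show ?thesis by (simp add: K_def)
  qed
  finally show ?thesis .
qed

end

theorem theorem5p1:
  fixes Q B :: "real^'n^'n" and s p t \<tau> :: real and f :: "real^'n \<Rightarrow> real"
  assumes "CARD('n) \<ge> 2"
    and "transpose Q = Q" and "\<forall>x. 0 \<le> x \<bullet> (Q *v x)"
    and "\<forall>t>0. pos_def_mat (Kmat Q B t)"
    and "trace B \<ge> 0"
    and "0 < s" "s < 1" and "1 \<le> p"
    and "schwartz f"
    and "0 < t" "0 < \<tau>"
  shows "Lp_norm p (\<lambda>X. Psemi Q B t f X - Psemi Q B \<tau> f X)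
     \<le> ennreal (2 * \<bar>t - \<tau>\<bar> powr s / Gamma (1 + s))
        * (SUP \<sigma>\<in>{0<..}. Lp_norm p (frac_pow Q B s (Psemi Q B \<sigma> f)))"
proof -
  interpret kolmogorov Q B using assms by unfold_locales auto
  define N where "N = (SUP \<sigma>\<in>{0<..}. Lp_norm p (frac_pow Q B s (Psemi Q B \<sigma> f)))"
  have ord: "Lp_norm p (\<lambda>X. Psemi Q B a f X - Psemi Q B b f X)
      \<le> ennreal (2 * (a - b) powr s / Gamma (1 + s)) * N" if "0 < b" "b < a" for a b
  proof -
    have c: "0 < 2 * (a - b) powr s / Gamma (1 + s)"
      using that assms(6) by (simp add: Gamma_real_pos)
    show ?thesis
    proof (cases N)
      case (real S)
      have "Lp_norm p (frac_pow Q B s (Psemi Q B \<sigma> f)) \<le> ennreal S" if "0 < \<sigma>" for \<sigma>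
        unfolding real(2)[symmetric] N_def using that by (intro SUP_upper) auto
      from Psemi_holder_ordered[OF assms(9,6,7,8) that real(1) this]
      show ?thesis unfolding real(2) ennreal_mult'[OF less_imp_le[OF c], symmetric] .
    next
      case top
      \<comment> \<open>Strict positivity of the constant matters here, since
        \<open>0 * \<top> = 0\<close> in \<open>ennreal\<close>.\<close>
      have "ennreal x * \<top> = \<top>" if "0 < x" for x
        using that by (simp add: ennreal_mult_top)
      from this[OF c] show ?thesis unfolding top by simp
    qed
  qed
  consider "\<tau> < t" | "t < \<tau>" | "t = \<tau>" by linarith
  then show ?thesis
  proof cases
    case 1
    then show ?thesis using ord[OF assms(11) 1] by (simp add: N_def)
  next
    case 2
    have "Lp_norm p (\<lambda>X. Psemi Q B t f X - Psemi Q B \<tau> f X) = Lp_norm p (\<lambda>X. Psemi Q B \<tau> f X - Psemi Q B t f X)"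
      unfolding Lp_norm_def by (simp only: abs_minus_commute)
    then show ?thesis using ord[OF assms(10) 2] 2 by (simp add: N_def)
  next
    case 3
    then show ?thesis using assms(8) by (simp add: Lp_norm_def)
  qed
qed

end
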